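(* Let $N\ge2$ and let $A\in M_N(\{0,1\})$ be primitive. The action of $\mathbb T\wr\mathrm{Aut}(A)$ on $O_A$ is never ergodic; that is, the fixed point algebra of this action on $O_A$ is strictly larger than $\mathbb C1$.
   Context: $A\in M_N(\{0,1\})$ primitive means some power of $A$ has strictly positive entries. $O_A$ is the universal $C^*$-algebra generated by $S_1,\dots,S_N$ with $\sum_jS_jS_j^*=1$ and $S_i^*S_k=\delta_{ik}\sum_jA_{ij}S_jS_j^*$. $\mathrm{Aut}(A)$ is the group of permutations $\pi$ of $\{1,\dots,N\}$ with $A_{\pi(i),\pi(j)}=A_{i,j}$ for all $i,j$; $\mathbb T\wr\mathrm{Aut}(A)=\mathbb T^N\rtimes\mathrm{Aut}(A)$ is the permutational wreath product, acting on $O_A$ by $*$-automorphisms generated by the multiparameter gauge automorphisms $S_i\mapsto z_iS_i$ ($z\in\mathbb T^N$) and the automorphisms $S_i\mapsto S_{\pi(i)}$ ($\pi\in\mathrm{Aut}(A)$). An action is ergodic if its fixed point algebra is $\mathbb C1$. *)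

theory Defs
  imports
    "HOL-Analysis.Abstract_Metric_Spaces"
    "HOL-Algebra.Module"
    "HOL-Algebra.Subrings"
    "HOL-Algebra.Group_Action"
    "HOL-Combinatorics.Permutations"
    "Jordan_Normal_Form.Matrix"
begin

section \<open>Unital C*-algebras\<close>

definition complex_ring :: "complex ring" where
  "complex_ring = \<lparr>carrier = UNIV, monoid.mult = (*), one = 1, zero = 0, add = (+)\<rparr>"

record 'a cstar_struct = "(complex, 'a) module" +
  adj :: "'a \<Rightarrow> 'a"
  cnrm :: "'a \<Rightarrow> real"

text \<open>
  The case distinction only serves to satisfy the convention of \<^locale>\<open>Metric_space\<close> that a metric
  is nonnegative and symmetric on the whole type.
\<close>

definition cdist :: "('a, 'm) cstar_struct_scheme \<Rightarrow> 'a \<Rightarrow> 'a \<Rightarrow> real" where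
  "cdist B x y = (if x \<in> carrier B \<and> y \<in> carrier B then cnrm B (x \<ominus>\<^bsub>B\<^esub> y) else 0)"

text \<open>
  Structures live on a carrier set rather than on a type, so that the universal property below
  can quantify over them.  The zero algebra is allowed.
\<close>

locale pre_cstar_algebra = module complex_ring B + ring B for B :: "('a, 'm) cstar_struct_scheme" (structure) +
  assumes smult_mult_left:
      "\<lbrakk>x \<in> carrier B; y \<in> carrier B\<rbrakk> \<Longrightarrow> (c \<odot> x) \<otimes> y = c \<odot> (x \<otimes> y)"
    and smult_mult_right:
      "\<lbrakk>x \<in> carrier B; y \<in> carrier B\<rbrakk> \<Longrightarrow> x \<otimes> (c \<odot> y) = c \<odot> (x \<otimes> y)"
    and adj_closed [simp, intro]: "x \<in> carrier B \<Longrightarrow> adj B x \<in> carrier B"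
    and adj_adj: "x \<in> carrier B \<Longrightarrow> adj B (adj B x) = x"
    and adj_add: "\<lbrakk>x \<in> carrier B; y \<in> carrier B\<rbrakk> \<Longrightarrow> adj B (x \<oplus> y) = adj B x \<oplus> adj B y"
    and adj_smult: "x \<in> carrier B \<Longrightarrow> adj B (c \<odot> x) = cnj c \<odot> adj B x"
    and adj_mult: "\<lbrakk>x \<in> carrier B; y \<in> carrier B\<rbrakk> \<Longrightarrow> adj B (x \<otimes> y) = adj B y \<otimes> adj B x"
    and cnrm_nonneg: "x \<in> carrier B \<Longrightarrow> 0 \<le> cnrm B x"
    and cnrm_eq_0_iff: "x \<in> carrier B \<Longrightarrow> cnrm B x = 0 \<longleftrightarrow> x = \<zero>"
    and cnrm_triangle:
      "\<lbrakk>x \<in> carrier B; y \<in> carrier B\<rbrakk> \<Longrightarrow> cnrm B (x \<oplus> y) \<le> cnrm B x + cnrm B y"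
    and cnrm_smult: "x \<in> carrier B \<Longrightarrow> cnrm B (c \<odot> x) = cmod c * cnrm B x"
    and cnrm_mult:
      "\<lbrakk>x \<in> carrier B; y \<in> carrier B\<rbrakk> \<Longrightarrow> cnrm B (x \<otimes> y) \<le> cnrm B x * cnrm B y"
    and cnrm_adj_mult: "x \<in> carrier B \<Longrightarrow> cnrm B (adj B x \<otimes> x) = (cnrm B x)\<^sup>2"
begin

lemma cnrm_minus:
  assumes x: "x \<in> carrier B"
  shows "cnrm B (\<ominus> x) = cnrm B x"
proof -
  have z: "\<zero> = (0::complex) \<odot> x"
    using x smult_l_null[of x] by (simp add: complex_ring_def)
  have "x \<oplus> (-1) \<odot> x = (1 + (-1)) \<odot> x"
    using x smult_l_distr[of 1 "-1" x] smult_one[of x] by (simp add: complex_ring_def)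
  then have "x \<oplus> (-1) \<odot> x = \<zero>"
    using z by simp
  moreover have "(-1) \<odot> x \<in> carrier B"
    using x by (intro smult_closed) (simp_all add: complex_ring_def)
  ultimately have "\<ominus> x = (-1) \<odot> x"
    using x by (metis M.minus_equality M.add.m_comm)
  then show ?thesis
    using cnrm_smult[OF x, of "-1"] by simp
qed

sublocale Metric_space "carrier B" "cdist B"
proof
  show "0 \<le> cdist B x y" for x y
    by (simp add: cdist_def cnrm_nonneg)
  show "cdist B x y = cdist B y x" for x y
  proof (cases "x \<in> carrier B \<and> y \<in> carrier B")
    case True
    then have "x \<ominus> y = \<ominus> (y \<ominus> x)"
      by (simp add: a_minus_def M.minus_add M.add.m_comm)
    with True show ?thesis
      by (simp add: cdist_def cnrm_minus)
  qed (auto simp: cdist_def)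
  show "cdist B x y = 0 \<longleftrightarrow> x = y" if "x \<in> carrier B" "y \<in> carrier B" for x y
    using that by (simp add: cdist_def cnrm_eq_0_iff)
  show "cdist B x z \<le> cdist B x y + cdist B y z"
    if "x \<in> carrier B" "y \<in> carrier B" "z \<in> carrier B" for x y z
  proof -
    have "x \<ominus> z = (x \<ominus> y) \<oplus> (y \<ominus> z)"
      using that by (simp add: a_minus_def M.a_assoc M.r_neg1)
    then show ?thesis
      using that cnrm_triangle[of "x \<ominus> y" "y \<ominus> z"] by (simp add: cdist_def)
  qed
qed

end

locale cstar_algebra = pre_cstar_algebra +
  assumes complete: "mcomplete"

definition star_hom ::
  "('a, 'm) cstar_struct_scheme \<Rightarrow> ('b, 'n) cstar_struct_scheme \<Rightarrow> ('a \<Rightarrow> 'b) set" where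
  "star_hom B C = {\<phi> \<in> Ring.ring_hom B C.
     (\<forall>c. \<forall>x\<in>carrier B. \<phi> (c \<odot>\<^bsub>B\<^esub> x) = c \<odot>\<^bsub>C\<^esub> \<phi> x) \<and>
     (\<forall>x\<in>carrier B. \<phi> (adj B x) = adj C (\<phi> x))}"

definition closed_star_subalgebra :: "('a, 'm) cstar_struct_scheme \<Rightarrow> 'a set \<Rightarrow> bool" where
  "closed_star_subalgebra B D \<longleftrightarrow>
     subring D B \<and>
     (\<forall>c. \<forall>x\<in>D. c \<odot>\<^bsub>B\<^esub> x \<in> D) \<and>
     (\<forall>x\<in>D. adj B x \<in> D) \<and>
     closedin (Metric_space.mtopology (carrier B) (cdist B)) D"

definition cstar_generated_by :: "('a, 'm) cstar_struct_scheme \<Rightarrow> 'a set \<Rightarrow> bool" where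
  "cstar_generated_by B X \<longleftrightarrow>
     X \<subseteq> carrier B \<and> (\<forall>D. closed_star_subalgebra B D \<and> X \<subseteq> D \<longrightarrow> D = carrier B)"

section \<open>Cuntz--Krieger algebras\<close>

text \<open>Indices run over \<open>{0, \<dots>, N - 1}\<close> instead of \<open>{1, \<dots>, N}\<close>.\<close>

definition zero_one_mat :: "nat \<Rightarrow> nat mat \<Rightarrow> bool" where
  "zero_one_mat N A \<longleftrightarrow> A \<in> carrier_mat N N \<and> (\<forall>i<N. \<forall>j<N. A $$ (i, j) \<in> {0, 1})"

definition primitive_mat :: "nat \<Rightarrow> nat mat \<Rightarrow> bool" where
  "primitive_mat N A \<longleftrightarrow> (\<exists>k\<ge>1. \<forall>i<N. \<forall>j<N. 0 < (A ^\<^sub>m k) $$ (i, j))"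

definition ck_family ::
  "nat \<Rightarrow> nat mat \<Rightarrow> ('a, 'm) cstar_struct_scheme \<Rightarrow> (nat \<Rightarrow> 'a) \<Rightarrow> bool" where
  "ck_family N A B S \<longleftrightarrow>
     (\<forall>i<N. S i \<in> carrier B) \<and>
     (\<Oplus>\<^bsub>B\<^esub>j\<in>{..<N}. S j \<otimes>\<^bsub>B\<^esub> adj B (S j)) = \<one>\<^bsub>B\<^esub> \<and>
     (\<forall>i<N. \<forall>k<N. adj B (S i) \<otimes>\<^bsub>B\<^esub> S k =
        (if i = k
         then \<Oplus>\<^bsub>B\<^esub>j\<in>{..<N}. of_nat (A $$ (i, j)) \<odot>\<^bsub>B\<^esub> (S j \<otimes>\<^bsub>B\<^esub> adj B (S j))
         else \<zero>\<^bsub>B\<^esub>))"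

text \<open>
  HOL cannot quantify over types inside a formula, so the algebras tested in the universal property
  live on one fixed type.  This loses nothing: a C*-algebra generated by \<open>N\<close> elements is separable,
  hence has at most continuum many elements, so every Cuntz--Krieger family is, after passing to
  the C*-algebra it generates, isomorphic to one on (a subset of) any type of cardinality
  at least the continuum.  The type chosen here also contains the bounded operators on
  \<open>\<ell>\<^sup>2\<close>, viewed as maps on sequences.
\<close>

type_synonym test_elem = "(nat \<Rightarrow> complex) \<Rightarrow> (nat \<Rightarrow> complex)"

text \<open>
  \<open>cuntz_krieger_algebra N A \<O> S\<close>: the C*-algebra \<open>\<O>\<close> with generators \<open>S\<close> is the universal
  C*-algebra \<open>\<O>\<^sub>A\<close>.  The homomorphism \<open>\<phi>\<close> is unique on the carrier since \<open>S\<close> generates.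
\<close>

definition cuntz_krieger_algebra ::
  "nat \<Rightarrow> nat mat \<Rightarrow> ('a, 'm) cstar_struct_scheme \<Rightarrow> (nat \<Rightarrow> 'a) \<Rightarrow> bool" where
  "cuntz_krieger_algebra N A \<O> S \<longleftrightarrow>
     cstar_algebra \<O> \<and>
     ck_family N A \<O> S \<and>
     cstar_generated_by \<O> (S ` {..<N}) \<and>
     (\<forall>(B :: test_elem cstar_struct) T. cstar_algebra B \<and> ck_family N A B T \<longrightarrow>
        (\<exists>\<phi>\<in>star_hom \<O> B. \<forall>i<N. \<phi> (S i) = T i))"

section \<open>The wreath product and its action\<close>

definition mat_aut :: "nat \<Rightarrow> nat mat \<Rightarrow> (nat \<Rightarrow> nat) set" where
  "mat_aut N A = {\<pi>. \<pi> permutes {..<N} \<and> (\<forall>i<N. \<forall>j<N. A $$ (\<pi> i, \<pi> j) = A $$ (i, j))}"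

definition torus :: "nat \<Rightarrow> (nat \<Rightarrow> complex) set" where
  "torus N = {..<N} \<rightarrow>\<^sub>E sphere 0 1"

abbreviation torus_one :: "nat \<Rightarrow> nat \<Rightarrow> complex" where
  "torus_one N \<equiv> (\<lambda>i\<in>{..<N}. 1)"

text \<open>
  \<open>\<pi>\<close> acts on \<open>\<T>\<^sup>N\<close> by \<open>(\<pi> \<cdot> w)\<^sub>i = w (\<pi>\<^sup>-\<^sup>1 i)\<close>.  This is the convention for which
  \<open>(z, \<pi>) \<mapsto> \<gamma>\<^sub>z \<circ> \<sigma>\<^sub>\<pi>\<close>, with \<open>\<gamma>\<^sub>z (S\<^sub>i) = z\<^sub>i S\<^sub>i\<close> and \<open>\<sigma>\<^sub>\<pi> (S\<^sub>i) = S (\<pi> i)\<close>, is multiplicative.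
\<close>

definition torus_wreath :: "nat \<Rightarrow> nat mat \<Rightarrow> ((nat \<Rightarrow> complex) \<times> (nat \<Rightarrow> nat)) monoid" where
  "torus_wreath N A =
     \<lparr>carrier = torus N \<times> mat_aut N A,
      monoid.mult = (\<lambda>(z, \<pi>) (w, \<rho>). (\<lambda>i\<in>{..<N}. z i * w (Hilbert_Choice.inv \<pi> i), \<pi> \<circ> \<rho>)),
      one = (torus_one N, id)\<rparr>"

lemma mat_aut_inv:
  assumes "\<pi> \<in> mat_aut N A"
  shows "Hilbert_Choice.inv \<pi> \<in> mat_aut N A"
proof -
  have p: "\<pi> permutes {..<N}" using assms by (simp add: mat_aut_def)
  have q: "Hilbert_Choice.inv \<pi> permutes {..<N}" using p by (rule permutes_inv)
  have "A $$ (Hilbert_Choice.inv \<pi> i, Hilbert_Choice.inv \<pi> j) = A $$ (i, j)" if "i < N" "j < N" for i j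
  proof -
    have "Hilbert_Choice.inv \<pi> i < N" "Hilbert_Choice.inv \<pi> j < N"
      using permutes_in_image[OF q] that by (metis lessThan_iff)+
    then have "A $$ (\<pi> (Hilbert_Choice.inv \<pi> i), \<pi> (Hilbert_Choice.inv \<pi> j))
      = A $$ (Hilbert_Choice.inv \<pi> i, Hilbert_Choice.inv \<pi> j)"
      using assms by (simp add: mat_aut_def)
    then show ?thesis by (simp add: permutes_inverses[OF p])
  qed
  with q show ?thesis by (simp add: mat_aut_def)
qed

lemma group_torus_wreath: "group (torus_wreath N A)"
proof (rule groupI)
  have lt: "\<pi> i < N" "Hilbert_Choice.inv \<pi> i < N" if "\<pi> \<in> mat_aut N A" "i < N" for \<pi> i
    using that mat_aut_inv[OF that(1)] permutes_in_image[of _ "{..<N}" i]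
    by (auto simp: mat_aut_def)
  have perm: "\<pi> permutes {..<N}" if "\<pi> \<in> mat_aut N A" for \<pi>
    using that by (simp add: mat_aut_def)
  have comp: "\<pi> \<circ> \<rho> \<in> mat_aut N A" if "\<pi> \<in> mat_aut N A" "\<rho> \<in> mat_aut N A" for \<pi> \<rho>
    using that lt by (auto simp: mat_aut_def intro: permutes_compose)
  have tm: "z \<in> torus N \<longleftrightarrow> z \<in> extensional {..<N} \<and> (\<forall>i<N. cmod (z i) = 1)" for z
    by (auto simp: torus_def PiE_def Pi_def)
  show "x \<otimes>\<^bsub>torus_wreath N A\<^esub> y \<in> carrier (torus_wreath N A)"
    if "x \<in> carrier (torus_wreath N A)" "y \<in> carrier (torus_wreath N A)" for x y
    using that comp lt by (auto simp: torus_wreath_def tm norm_mult)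
  show "\<one>\<^bsub>torus_wreath N A\<^esub> \<in> carrier (torus_wreath N A)"
    by (auto simp: torus_wreath_def tm mat_aut_def permutes_id)
  show "x \<otimes>\<^bsub>torus_wreath N A\<^esub> y \<otimes>\<^bsub>torus_wreath N A\<^esub> u =
      x \<otimes>\<^bsub>torus_wreath N A\<^esub> (y \<otimes>\<^bsub>torus_wreath N A\<^esub> u)"
    if "x \<in> carrier (torus_wreath N A)" "y \<in> carrier (torus_wreath N A)"
      "u \<in> carrier (torus_wreath N A)" for x y u
    using that lt
    by (auto simp: torus_wreath_def fun_eq_iff restrict_def mult.assoc
        o_inv_distrib[OF permutes_bij permutes_bij, OF perm perm])
  show "\<one>\<^bsub>torus_wreath N A\<^esub> \<otimes>\<^bsub>torus_wreath N A\<^esub> x = x"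
    if "x \<in> carrier (torus_wreath N A)" for x
    using that by (auto simp: torus_wreath_def tm fun_eq_iff extensional_def)
  show "\<exists>y\<in>carrier (torus_wreath N A). y \<otimes>\<^bsub>torus_wreath N A\<^esub> x = \<one>\<^bsub>torus_wreath N A\<^esub>"
    if "x \<in> carrier (torus_wreath N A)" for x
  proof -
    obtain z \<pi> where x: "x = (z, \<pi>)" "z \<in> torus N" "\<pi> \<in> mat_aut N A"
      using \<open>x \<in> carrier (torus_wreath N A)\<close> by (auto simp: torus_wreath_def)
    have nz: "z (\<pi> i) \<noteq> 0" if "i < N" for i
      using x lt[OF x(3) that] by (auto simp: tm)
    let ?y = "(\<lambda>i\<in>{..<N}. inverse (z (\<pi> i)), Hilbert_Choice.inv \<pi>)"
    have "?y \<in> carrier (torus_wreath N A)"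
      using x lt mat_aut_inv by (auto simp: torus_wreath_def tm norm_inverse)
    moreover have "?y \<otimes>\<^bsub>torus_wreath N A\<^esub> x = \<one>\<^bsub>torus_wreath N A\<^esub>"
      using nz permutes_inv_inv[OF perm[OF x(3)]] permutes_inv_o[OF perm[OF x(3)]]
      by (auto simp: x(1) torus_wreath_def fun_eq_iff restrict_def)
    ultimately show ?thesis by blast
  qed
qed

text \<open>
  These conditions determine \<open>\<alpha>\<close>: \<open>(z, \<pi>) = (z, id) \<otimes> (1, \<pi>)\<close>, and a *-automorphism is determined
  by its values on the generators.
\<close>

definition wreath_action ::
  "nat \<Rightarrow> nat mat \<Rightarrow> ('a, 'm) cstar_struct_scheme \<Rightarrow> (nat \<Rightarrow> 'a) \<Rightarrow>
   ((nat \<Rightarrow> complex) \<times> (nat \<Rightarrow> nat) \<Rightarrow> 'a \<Rightarrow> 'a) \<Rightarrow> bool" where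
  "wreath_action N A \<O> S \<alpha> \<longleftrightarrow>
     group_action (torus_wreath N A) (carrier \<O>) \<alpha> \<and>
     (\<forall>g\<in>carrier (torus_wreath N A). \<alpha> g \<in> star_hom \<O> \<O>) \<and>
     (\<forall>z\<in>torus N. \<forall>i<N. \<alpha> (z, id) (S i) = z i \<odot>\<^bsub>\<O>\<^esub> S i) \<and>
     (\<forall>\<pi>\<in>mat_aut N A. \<forall>i<N. \<alpha> (torus_one N, \<pi>) (S i) = S (\<pi> i))"

definition fixed_point_algebra ::
  "('g, 'k) monoid_scheme \<Rightarrow> ('a, 'm) cstar_struct_scheme \<Rightarrow> ('g \<Rightarrow> 'a \<Rightarrow> 'a) \<Rightarrow> 'a set" where
  "fixed_point_algebra G B \<alpha> = {x \<in> carrier B. \<forall>g\<in>carrier G. \<alpha> g x = x}"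

definition scalars :: "('a, 'm) cstar_struct_scheme \<Rightarrow> 'a set" where
  "scalars B = {c \<odot>\<^bsub>B\<^esub> \<one>\<^bsub>B\<^esub> | c. True}"

definition ergodic_action ::
  "('g, 'k) monoid_scheme \<Rightarrow> ('a, 'm) cstar_struct_scheme \<Rightarrow> ('g \<Rightarrow> 'a \<Rightarrow> 'a) \<Rightarrow> bool" where
  "ergodic_action G B \<alpha> \<longleftrightarrow> fixed_point_algebra G B \<alpha> = scalars B"

end

theory Submission
  imports Defs "HOL-Analysis.Bounded_Linear_Function" "HOL-Analysis.Infinite_Sum"
begin

text \<open>
  Choose \<open>k\<close> with \<open>A\<^sup>k\<close> positive and consider \<open>p = \<Sum>\<^sub>\<mu> S\<^sub>\<mu> S\<^sub>\<mu>\<^sup>*\<close>, the sum over the words \<open>\<mu>\<close> of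
  length \<open>k + 1\<close> whose first and last letters agree.  Gauge automorphisms fix every summand and
  automorphisms of \<open>A\<close> permute the summands, so \<open>p\<close> is a fixed point.  To see that \<open>p\<close> is not a
  scalar, partition the natural numbers into infinite sets \<open>R\<^sub>i\<close> and choose \<open>\<sigma>\<close> mapping each \<open>R\<^sub>i\<close>
  bijectively onto the union of the \<open>R\<^sub>j\<close> with \<open>A\<^sub>i\<^sub>j = 1\<close>.  Composition with the restrictions of \<open>\<sigma>\<close>
  to the \<open>R\<^sub>i\<close> is a Cuntz--Krieger family on \<open>\<ell>\<^sup>2\<close>, and it maps \<open>p\<close> to the diagonal projection
  onto the points \<open>n\<close> such that \<open>n\<close> and \<open>\<sigma>\<^sup>k n\<close> lie in the same \<open>R\<^sub>i\<close>.  As \<open>A\<^sup>k\<close> is positive and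
  \<open>N \<ge> 2\<close>, some but not all points have this property.
\<close>

section \<open>The Hilbert space of square summable sequences\<close>

typedef ell2 = "{x :: nat \<Rightarrow> complex. (\<lambda>n. (cmod (x n))\<^sup>2) summable_on UNIV}"
  morphisms coord Abs_ell2
  by (rule exI[of _ "\<lambda>_. 0"]) simp

setup_lifting type_definition_ell2

lemma summable_coord: "(\<lambda>n. (cmod (coord x n))\<^sup>2) summable_on UNIV"
  using coord[of x] by simp

lemma ell2_eqI: "(\<And>n. coord x n = coord y n) \<Longrightarrow> x = y"
  by (simp add: coord_inject[symmetric] fun_eq_iff)

lemma square_summable_add:
  assumes "(\<lambda>n. (cmod (x n))\<^sup>2) summable_on I" "(\<lambda>n. (cmod (y n))\<^sup>2) summable_on I"
  shows "(\<lambda>n. (cmod (x n + y n))\<^sup>2) summable_on I"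
proof (rule summable_on_comparison_test)
  show "(\<lambda>n. 2 * (cmod (x n))\<^sup>2 + 2 * (cmod (y n))\<^sup>2) summable_on I"
    using assms by (intro summable_on_add summable_on_cmult_right)
  show "(cmod (x n + y n))\<^sup>2 \<le> 2 * (cmod (x n))\<^sup>2 + 2 * (cmod (y n))\<^sup>2" for n
  proof -
    have "(cmod (x n + y n))\<^sup>2 \<le> (cmod (x n) + cmod (y n))\<^sup>2"
      by (intro power_mono norm_triangle_ineq) simp
    also have "\<dots> \<le> 2 * (cmod (x n))\<^sup>2 + 2 * (cmod (y n))\<^sup>2"
      using sum_squares_bound[of "cmod (x n)" "cmod (y n)"] by (simp add: power2_sum)
    finally show ?thesis .
  qed
qed simp

lemma square_summable_cmult:
  "(\<lambda>n. (cmod (x n))\<^sup>2) summable_on I \<Longrightarrow> (\<lambda>n. (cmod (c * x n))\<^sup>2) summable_on I"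
  by (simp add: norm_mult power_mult_distrib summable_on_cmult_right)

instantiation ell2 :: ab_group_add
begin

lift_definition zero_ell2 :: ell2 is "\<lambda>_. 0" by simp

lift_definition plus_ell2 :: "ell2 \<Rightarrow> ell2 \<Rightarrow> ell2" is "\<lambda>x y n. x n + y n"
  by (rule square_summable_add)

lift_definition uminus_ell2 :: "ell2 \<Rightarrow> ell2" is "\<lambda>x n. - x n" by simp

lift_definition minus_ell2 :: "ell2 \<Rightarrow> ell2 \<Rightarrow> ell2" is "\<lambda>x y n. x n - y n"
  using square_summable_add[where y = "\<lambda>n. - _ n"] by simp

instance by standard (transfer; simp add: fun_eq_iff)+

end

section \<open>Inner product and norm of square summable sequences\<close>

lemma square_summable_inner:
  assumes "(\<lambda>n. (cmod (x n))\<^sup>2) summable_on I" "(\<lambda>n. (cmod (y n))\<^sup>2) summable_on I"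
  shows "(\<lambda>n. inner (x n) (y n)) summable_on I"
proof (rule abs_summable_summable, rule summable_on_comparison_test)
  show "(\<lambda>n. (cmod (x n))\<^sup>2 + (cmod (y n))\<^sup>2) summable_on I"
    using assms by (rule summable_on_add)
  show "norm (inner (x n) (y n)) \<le> (cmod (x n))\<^sup>2 + (cmod (y n))\<^sup>2" for n
  proof -
    have "norm (inner (x n) (y n)) \<le> cmod (x n) * cmod (y n)"
      using Cauchy_Schwarz_ineq2[of "x n" "y n"] by simp
    also have "\<dots> \<le> (cmod (x n))\<^sup>2 + (cmod (y n))\<^sup>2"
      using sum_squares_bound[of "cmod (x n)" "cmod (y n)"]
        mult_nonneg_nonneg[OF norm_ge_zero norm_ge_zero, of "x n" "y n"] by linarith
    finally show ?thesis .
  qed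
qed simp

lemma summable_inner_coord: "(\<lambda>n. inner (coord x n) (coord y n)) summable_on UNIV"
  by (intro square_summable_inner summable_coord)

lift_definition cscale :: "complex \<Rightarrow> ell2 \<Rightarrow> ell2" is "\<lambda>c x n. c * x n"
  by (rule square_summable_cmult)

text \<open>Only the real part of the complex inner product is recorded. It determines the same
  norm; complex linearity is imposed separately, as commutation with complex scalars.\<close>

instantiation ell2 :: real_inner
begin

definition scaleR_ell2 :: "real \<Rightarrow> ell2 \<Rightarrow> ell2"
  where "scaleR_ell2 r = cscale (of_real r)"

lift_definition inner_ell2 :: "ell2 \<Rightarrow> ell2 \<Rightarrow> real"
  is "\<lambda>x y. \<Sum>\<^sub>\<infinity>n. inner (x n) (y n)" .

definition norm_ell2 :: "ell2 \<Rightarrow> real" where "norm_ell2 x = sqrt (inner x x)"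

definition sgn_ell2 :: "ell2 \<Rightarrow> ell2" where "sgn_ell2 x = scaleR (inverse (norm x)) x"

definition dist_ell2 :: "ell2 \<Rightarrow> ell2 \<Rightarrow> real" where "dist_ell2 x y = norm (x - y)"

definition uniformity_ell2 :: "(ell2 \<times> ell2) filter"
  where "uniformity_ell2 = (INF e\<in>{0 <..}. principal {(x, y). dist x y < e})"

definition open_ell2 :: "ell2 set \<Rightarrow> bool"
  where "open_ell2 U = (\<forall>x\<in>U. \<forall>\<^sub>F (x', y) in uniformity. x' = x \<longrightarrow> y \<in> U)"

instance
proof
  fix x y z :: ell2 and a b :: real
  show "a *\<^sub>R (x + y) = a *\<^sub>R x + a *\<^sub>R y" "(a + b) *\<^sub>R x = a *\<^sub>R x + b *\<^sub>R x"
    "a *\<^sub>R b *\<^sub>R x = (a * b) *\<^sub>R x" "1 *\<^sub>R x = x"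
    unfolding scaleR_ell2_def by (transfer; simp add: fun_eq_iff algebra_simps)+
  show "inner x y = inner y x"
    by transfer (simp add: inner_commute)
  show "inner (x + y) z = inner x z + inner y z"
    by transfer (simp add: inner_add_left infsum_add square_summable_inner)
  show "inner (a *\<^sub>R x) y = a * inner x y"
  proof -
    have "inner (of_real a * c) d = a * inner c d" for c d :: complex
      by (simp add: inner_complex_def algebra_simps)
    then show ?thesis
      unfolding scaleR_ell2_def by transfer (simp add: infsum_cmult_right')
  qed
  show "0 \<le> inner x x"
    by transfer (simp add: infsum_nonneg)
  show "inner x x = 0 \<longleftrightarrow> x = 0"
  proof
    assume *: "inner x x = 0"
    have "coord x n = 0" for n
    proof -
      have "inner (coord x n) (coord x n) = 0"
        by (rule nonneg_infsum_le_0D[of _ UNIV])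
          (use * summable_inner_coord in \<open>auto simp: inner_ell2.rep_eq\<close>)
      then show ?thesis by simp
    qed
    then show "x = 0" by (intro ell2_eqI) (simp add: zero_ell2.rep_eq)
  qed (simp add: inner_ell2.rep_eq zero_ell2.rep_eq)
qed (rule sgn_ell2_def dist_ell2_def uniformity_ell2_def open_ell2_def norm_ell2_def)+

end

lemma coord_scaleR: "coord (r *\<^sub>R x) n = of_real r * coord x n"
  by (simp add: scaleR_ell2_def cscale.rep_eq)

lemma norm_ell2_sq: "(norm x)\<^sup>2 = (\<Sum>\<^sub>\<infinity>n. (cmod (coord x n))\<^sup>2)"
  by (simp add: norm_eq_sqrt_inner inner_ell2.rep_eq power2_norm_eq_inner infsum_nonneg)

lemma sum_coord_le_norm: "finite F \<Longrightarrow> (\<Sum>n\<in>F. (cmod (coord x n))\<^sup>2) \<le> (norm x)\<^sup>2"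
  unfolding norm_ell2_sq by (rule finite_sum_le_infsum[OF summable_coord]) auto

lemma coord_le_norm: "cmod (coord x n) \<le> norm x"
  using sum_coord_le_norm[of "{n}" x] by (simp add: power2_le_iff_abs_le)

text \<open>Each coordinate is dominated by the norm, so a Cauchy sequence converges coordinatewise.
  Bounds on finite partial sums pass to the limit; being uniform in the finite set, they show both
  that the limit is square summable and that convergence holds in norm.\<close>

instance ell2 :: complete_space
proof
  fix X :: "nat \<Rightarrow> ell2"
  assume "Cauchy X"
  then have X: "\<exists>M. \<forall>i\<ge>M. \<forall>j\<ge>M. norm (X i - X j) < e" if "e > 0" for e
    using that by (simp add: Cauchy_def dist_norm)
  have "Cauchy (\<lambda>m. coord (X m) n)" for n
    unfolding Cauchy_def dist_norm
  proof (intro allI impI)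
    fix e :: real assume "e > 0"
    then obtain M where M: "\<And>i j. i \<ge> M \<Longrightarrow> j \<ge> M \<Longrightarrow> norm (X i - X j) < e"
      using X by meson
    have "cmod (coord (X i) n - coord (X j) n) < e" if "i \<ge> M" "j \<ge> M" for i j
      using M[OF that] coord_le_norm[of "X i - X j" n] by (simp add: minus_ell2.rep_eq)
    then show "\<exists>M. \<forall>i\<ge>M. \<forall>j\<ge>M. cmod (coord (X i) n - coord (X j) n) < e" by blast
  qed
  then obtain L where L: "\<And>n. (\<lambda>m. coord (X m) n) \<longlonglongrightarrow> L n"
    unfolding Cauchy_convergent_iff convergent_def by metis
  \<comment> \<open>Over a fixed finite set \<open>F\<close> the second index of the Cauchy estimate
    can tend to infinity term by term; \<open>M\<close> does not depend on \<open>F\<close>.\<close>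
  have tail: "\<exists>M. \<forall>m\<ge>M. \<forall>F. finite F \<longrightarrow> (\<Sum>n\<in>F. (cmod (coord (X m) n - L n))\<^sup>2) \<le> e\<^sup>2"
    if "e > 0" for e :: real
  proof -
    obtain M where M: "\<And>i j. i \<ge> M \<Longrightarrow> j \<ge> M \<Longrightarrow> norm (X i - X j) < e"
      using X[OF \<open>e > 0\<close>] by blast
    have "(\<Sum>n\<in>F. (cmod (coord (X m) n - L n))\<^sup>2) \<le> e\<^sup>2" if "m \<ge> M" "finite F" for m F
    proof (rule tendsto_upperbound)
      show "(\<lambda>j. \<Sum>n\<in>F. (cmod (coord (X m) n - coord (X j) n))\<^sup>2)
          \<longlonglongrightarrow> (\<Sum>n\<in>F. (cmod (coord (X m) n - L n))\<^sup>2)"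
        by (intro tendsto_intros L)
      show "\<forall>\<^sub>F j in sequentially. (\<Sum>n\<in>F. (cmod (coord (X m) n - coord (X j) n))\<^sup>2) \<le> e\<^sup>2"
        using eventually_ge_at_top[of M]
      proof eventually_elim
        case (elim j)
        have "(\<Sum>n\<in>F. (cmod (coord (X m) n - coord (X j) n))\<^sup>2) \<le> (norm (X m - X j))\<^sup>2"
          using sum_coord_le_norm[OF \<open>finite F\<close>, of "X m - X j"] by (simp add: minus_ell2.rep_eq)
        also have "\<dots> \<le> e\<^sup>2"
          using M[OF \<open>m \<ge> M\<close> elim] by (intro power_mono) auto
        finally show ?case .
      qed
    qed simp
    then show ?thesis by blast
  qed
  have diff: "(\<lambda>n. (cmod (coord (X m) n - L n))\<^sup>2) summable_on UNIV"
    if "\<forall>F. finite F \<longrightarrow> (\<Sum>n\<in>F. (cmod (coord (X m) n - L n))\<^sup>2) \<le> e\<^sup>2" for m e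
    using that by (intro nonneg_bdd_above_summable_on) (auto intro!: bdd_aboveI[of _ "e\<^sup>2"])
  \<comment> \<open>One index close to the limit suffices for square summability of
    \<open>L\<close>, since \<open>L\<close> differs from \<open>coord (X M)\<close> by a square
    summable sequence.\<close>
  obtain M where "\<forall>F. finite F \<longrightarrow> (\<Sum>n\<in>F. (cmod (coord (X M) n - L n))\<^sup>2) \<le> 1\<^sup>2"
    using tail[of 1] by auto
  note diff[OF this]
  then have "(\<lambda>n. (cmod (- (coord (X M) n - L n) + coord (X M) n))\<^sup>2) summable_on UNIV"
    by (intro square_summable_add summable_coord) (simp add: norm_minus_commute)
  then have LL: "coord (Abs_ell2 L) = L"
    by (intro Abs_ell2_inverse) simp
  have "X \<longlonglongrightarrow> Abs_ell2 L"
  proof (rule metric_LIMSEQ_I)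
    fix r :: real assume "r > 0"
    \<comment> \<open>The tail bound is not strict; using \<open>r/2\<close> leaves room for the
      strict inequality.\<close>
    then obtain M where M: "\<And>m F. m \<ge> M \<Longrightarrow> finite F \<Longrightarrow>
        (\<Sum>n\<in>F. (cmod (coord (X m) n - L n))\<^sup>2) \<le> (r/2)\<^sup>2"
      using tail[of "r/2"] by auto
    have "dist (X m) (Abs_ell2 L) < r" if "m \<ge> M" for m
    proof -
      have "(norm (X m - Abs_ell2 L))\<^sup>2 \<le> (r/2)\<^sup>2"
        unfolding norm_ell2_sq
        using M[OF that] diff[of m "r/2"]
        by (intro infsum_le_finite_sums) (auto simp: minus_ell2.rep_eq LL)
      then have "norm (X m - Abs_ell2 L) \<le> r/2"
        using \<open>r > 0\<close> by (simp add: power2_le_iff_abs_le)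
      then show ?thesis using \<open>r > 0\<close> by (simp add: dist_norm)
    qed
    then show "\<exists>M. \<forall>m\<ge>M. dist (X m) (Abs_ell2 L) < r" by blast
  qed
  then show "convergent X" by (auto simp: convergent_def)
qed

instance ell2 :: banach ..

section \<open>Complex scalars as operators\<close>

lemma norm_cscale: "norm (cscale c x) = cmod c * norm x"
proof -
  have "(norm (cscale c x))\<^sup>2 = (cmod c * norm x)\<^sup>2"
    by (simp add: norm_ell2_sq cscale.rep_eq norm_mult power_mult_distrib infsum_cmult_right')
  then show ?thesis by (simp add: power2_eq_iff_nonneg)
qed

lemma inner_cscale: "inner (cscale c x) y = inner x (cscale (cnj c) y)"
proof -
  have "inner (c * a) b = inner a (cnj c * b)" for a b :: complex
    by (simp add: inner_complex_def algebra_simps)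
  then show ?thesis by (simp add: inner_ell2.rep_eq cscale.rep_eq)
qed

lemma bounded_linear_cscale: "bounded_linear (cscale c)"
  by (rule bounded_linear_intro[where K = "cmod c"])
    (auto simp: norm_cscale mult.commute plus_ell2.rep_eq cscale.rep_eq coord_scaleR
      distrib_left intro!: ell2_eqI)

text \<open>Bounded operators here are real linear. With a complex scalar turned into an operator,
  scalar multiplication of operators becomes composition, and complex linearity becomes
  commutation.\<close>

lift_definition mult_op :: "complex \<Rightarrow> ell2 \<Rightarrow>\<^sub>L ell2" is cscale
  by (rule bounded_linear_cscale)

lemma mult_op_add: "mult_op (a + b) = mult_op a + mult_op b"
  by (intro blinfun_eqI ell2_eqI)
    (simp add: mult_op.rep_eq cscale.rep_eq plus_blinfun.rep_eq plus_ell2.rep_eq distrib_right)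

lemma mult_op_mult: "mult_op (a * b) = mult_op a o\<^sub>L mult_op b"
  by (intro blinfun_eqI ell2_eqI) (simp add: mult_op.rep_eq cscale.rep_eq mult.assoc)

lemma mult_op_one: "mult_op 1 = id_blinfun"
  by (intro blinfun_eqI ell2_eqI) (simp add: mult_op.rep_eq cscale.rep_eq)

lemma blinfun_compose_assoc: "(a o\<^sub>L b) o\<^sub>L c = a o\<^sub>L (b o\<^sub>L c)"
  by (rule blinfun_eqI) simp

lemma blinfun_compose_id: "id_blinfun o\<^sub>L a = a" "a o\<^sub>L id_blinfun = a"
  by (rule blinfun_eqI; simp)+

text \<open>The upper bound holds for all scalars and operators; applied to \<open>inverse c\<close>
  and \<open>mult_op c o\<^sub>L T\<close> it yields the lower bound.\<close>

lemma norm_mult_op_compose: "norm (mult_op c o\<^sub>L T) = cmod c * norm T"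
proof (rule antisym)
  have le: "norm (mult_op c o\<^sub>L T) \<le> cmod c * norm T" for c T
    by (rule norm_blinfun_bound)
      (auto simp: mult_op.rep_eq norm_cscale mult.assoc intro!: mult_left_mono norm_blinfun)
  show "norm (mult_op c o\<^sub>L T) \<le> cmod c * norm T" by (rule le)
  show "cmod c * norm T \<le> norm (mult_op c o\<^sub>L T)"
  proof (cases "c = 0")
    case False
    have "T = mult_op (inverse c) o\<^sub>L (mult_op c o\<^sub>L T)"
      using False
      by (simp add: mult_op_mult[symmetric] mult_op_one blinfun_compose_assoc[symmetric]
          blinfun_compose_id)
    then have "norm T \<le> cmod (inverse c) * norm (mult_op c o\<^sub>L T)"
      using le by metis
    then show ?thesis using False by (simp add: norm_divide field_simps)
  qed simp
qed

section \<open>Adjointable operators form a C*-algebra\<close>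

text \<open>Adjointness is a relation, so that existence of an adjoint becomes a condition on the
  operator and need not be derived from a representation theorem.\<close>

definition adjoint_pair :: "('h::real_inner \<Rightarrow>\<^sub>L 'h) \<Rightarrow> ('h \<Rightarrow>\<^sub>L 'h) \<Rightarrow> bool" where
  "adjoint_pair T U \<longleftrightarrow> (\<forall>x y. inner (T x) y = inner x (U y))"

lemma adjoint_pair_sym: "adjoint_pair T U \<Longrightarrow> adjoint_pair U T"
  by (simp add: adjoint_pair_def inner_commute)

lemma adjoint_pair_unique: "adjoint_pair T U \<Longrightarrow> adjoint_pair T V \<Longrightarrow> U = V"
  unfolding adjoint_pair_def
  by (intro blinfun_eqI) (metis vector_eq_rdot inner_commute)

lemma adjoint_pair_add: "adjoint_pair T U \<Longrightarrow> adjoint_pair T' U' \<Longrightarrow> adjoint_pair (T + T') (U + U')"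
  by (simp add: adjoint_pair_def plus_blinfun.rep_eq inner_add_left inner_add_right)

lemma adjoint_pair_diff: "adjoint_pair T U \<Longrightarrow> adjoint_pair T' U' \<Longrightarrow> adjoint_pair (T - T') (U - U')"
  by (simp add: adjoint_pair_def minus_blinfun.rep_eq inner_diff_left inner_diff_right)

lemma adjoint_pair_uminus: "adjoint_pair T U \<Longrightarrow> adjoint_pair (- T) (- U)"
  by (simp add: adjoint_pair_def uminus_blinfun.rep_eq)

lemma adjoint_pair_0: "adjoint_pair 0 0"
  by (simp add: adjoint_pair_def)

lemma adjoint_pair_id: "adjoint_pair id_blinfun id_blinfun"
  by (simp add: adjoint_pair_def)

lemma adjoint_pair_compose:
  "adjoint_pair T U \<Longrightarrow> adjoint_pair T' U' \<Longrightarrow> adjoint_pair (T o\<^sub>L T') (U' o\<^sub>L U)"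
  by (simp add: adjoint_pair_def)

text \<open>By Cauchy-Schwarz, the square of the norm of \<open>T x\<close>, which is the inner
  product of \<open>x\<close> and \<open>U (T x)\<close>, is at most
  \<open>norm (U o\<^sub>L T)\<close> times the square of the norm of \<open>x\<close>. This is the
  nontrivial half of the C*-identity.\<close>

lemma adjoint_pair_norm_le:
  assumes "adjoint_pair T U"
  shows "(norm T)\<^sup>2 \<le> norm (U o\<^sub>L T)"
proof -
  have "norm (T x) \<le> sqrt (norm (U o\<^sub>L T)) * norm x" for x
  proof -
    have "(norm (T x))\<^sup>2 = inner x ((U o\<^sub>L T) x)"
      using assms by (simp add: adjoint_pair_def power2_norm_eq_inner)
    also have "\<dots> \<le> norm x * norm ((U o\<^sub>L T) x)"
      by (rule norm_cauchy_schwarz)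
    also have "\<dots> \<le> norm x * (norm (U o\<^sub>L T) * norm x)"
      by (intro mult_left_mono norm_blinfun) simp
    also have "\<dots> = (sqrt (norm (U o\<^sub>L T)) * norm x)\<^sup>2"
      by (simp add: power_mult_distrib power2_eq_square)
    finally show ?thesis by (rule power2_le_imp_le) simp
  qed
  then have "norm T \<le> sqrt (norm (U o\<^sub>L T))"
    by (intro norm_blinfun_bound) auto
  then have "(norm T)\<^sup>2 \<le> (sqrt (norm (U o\<^sub>L T)))\<^sup>2"
    by (rule power_mono) simp
  then show ?thesis by simp
qed

text \<open>The previous bound and submultiplicativity give
  \<open>norm T * norm T \<le> norm U * norm T\<close>; cancel \<open>norm T\<close> and use the
  symmetry of the relation.\<close>

lemma adjoint_pair_norm:
  assumes "adjoint_pair T U"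
  shows "norm U = norm T"
proof -
  have le: "norm T \<le> norm U" if "adjoint_pair T U" for T U :: "'a \<Rightarrow>\<^sub>L 'a"
  proof (cases "norm T = 0")
    case False
    have "norm T * norm T \<le> norm U * norm T"
      using adjoint_pair_norm_le[OF that] norm_blinfun_compose[of U T]
      by (simp add: power2_eq_square)
    with False show ?thesis by simp
  qed simp
  show ?thesis
    using le[OF assms] le[OF adjoint_pair_sym[OF assms]] by simp
qed

lemma adjoint_pair_cstar_identity:
  assumes "adjoint_pair T U"
  shows "norm (U o\<^sub>L T) = (norm T)\<^sup>2"
  using adjoint_pair_norm_le[OF assms] norm_blinfun_compose[of U T] adjoint_pair_norm[OF assms]
  by (simp add: power2_eq_square)

lemmas blinfun_compose_bilinear =
  bounded_bilinear.add_left[OF bounded_bilinear_blinfun_compose]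
  bounded_bilinear.add_right[OF bounded_bilinear_blinfun_compose]
  bounded_bilinear.minus_left[OF bounded_bilinear_blinfun_compose]
  bounded_bilinear.minus_right[OF bounded_bilinear_blinfun_compose]

section \<open>Complex linear operators that have an adjoint\<close>

lemma adjoint_pair_mult_op: "adjoint_pair (mult_op c) (mult_op (cnj c))"
  by (simp add: adjoint_pair_def mult_op.rep_eq inner_cscale)

text \<open>The adjoint is taken for the real inner product; for complex linear operators it agrees
  with the complex adjoint.\<close>

definition adjointables :: "(ell2 \<Rightarrow>\<^sub>L ell2) set" where
  "adjointables = {T. (\<forall>c. mult_op c o\<^sub>L T = T o\<^sub>L mult_op c) \<and> (\<exists>U. adjoint_pair T U)}"

definition op_adj :: "(ell2 \<Rightarrow>\<^sub>L ell2) \<Rightarrow> (ell2 \<Rightarrow>\<^sub>L ell2)" where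
  "op_adj T = (THE U. adjoint_pair T U)"

lemma op_adj_eq: "adjoint_pair T U \<Longrightarrow> op_adj T = U"
  unfolding op_adj_def by (blast intro: adjoint_pair_unique)

lemma adjointables_commute: "T \<in> adjointables \<Longrightarrow> mult_op c o\<^sub>L T = T o\<^sub>L mult_op c"
  by (simp add: adjointables_def)

lemma adjoint_pair_op_adj: "T \<in> adjointables \<Longrightarrow> adjoint_pair T (op_adj T)"
  by (auto simp: adjointables_def op_adj_eq)

lemma adjointablesI:
  "(\<And>c. mult_op c o\<^sub>L T = T o\<^sub>L mult_op c) \<Longrightarrow> adjoint_pair T U \<Longrightarrow> T \<in> adjointables"
  by (auto simp: adjointables_def)

lemma adjointables_0: "0 \<in> adjointables"
  by (rule adjointablesI[OF _ adjoint_pair_0]) simp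

lemma adjointables_id: "id_blinfun \<in> adjointables"
  by (rule adjointablesI[OF _ adjoint_pair_id]) (simp add: blinfun_compose_id)

lemma adjointables_add: "T \<in> adjointables \<Longrightarrow> U \<in> adjointables \<Longrightarrow> T + U \<in> adjointables"
  by (rule adjointablesI[OF _ adjoint_pair_add[OF adjoint_pair_op_adj adjoint_pair_op_adj]])
    (auto simp: adjointables_commute blinfun_compose_bilinear)

lemma adjointables_uminus: "T \<in> adjointables \<Longrightarrow> - T \<in> adjointables"
  by (rule adjointablesI[OF _ adjoint_pair_uminus[OF adjoint_pair_op_adj]])
    (auto simp: adjointables_commute blinfun_compose_bilinear)

lemma adjointables_compose: "T \<in> adjointables \<Longrightarrow> U \<in> adjointables \<Longrightarrow> T o\<^sub>L U \<in> adjointables"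
  by (rule adjointablesI[OF _ adjoint_pair_compose[OF adjoint_pair_op_adj adjoint_pair_op_adj]])
    (auto simp: adjointables_commute blinfun_compose_assoc[symmetric], 
      simp add: adjointables_commute blinfun_compose_assoc)

lemma mult_op_commute: "mult_op a o\<^sub>L mult_op b = mult_op b o\<^sub>L mult_op a"
  by (simp add: mult_op_mult[symmetric] mult.commute)

lemma adjointables_mult_op: "mult_op c \<in> adjointables"
  by (rule adjointablesI[OF mult_op_commute adjoint_pair_mult_op])

text \<open>\<open>T\<close> commutes with \<open>mult_op (cnj c)\<close>. Taking adjoints on both
  sides turns this into commutation of \<open>op_adj T\<close> with \<open>mult_op c\<close>,
  because adjoints are unique.\<close>

lemma adjointables_op_adj:
  assumes "T \<in> adjointables"
  shows "op_adj T \<in> adjointables"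
proof (rule adjointablesI[OF _ adjoint_pair_sym[OF adjoint_pair_op_adj[OF assms]]])
  fix c
  have "adjoint_pair (T o\<^sub>L mult_op (cnj c)) (mult_op c o\<^sub>L op_adj T)"
    using adjoint_pair_compose[OF adjoint_pair_op_adj[OF assms] adjoint_pair_mult_op[of "cnj c"]] by simp
  moreover have "adjoint_pair (mult_op (cnj c) o\<^sub>L T) (op_adj T o\<^sub>L mult_op c)"
    using adjoint_pair_compose[OF adjoint_pair_mult_op[of "cnj c"] adjoint_pair_op_adj[OF assms]] by simp
  ultimately show "mult_op c o\<^sub>L op_adj T = op_adj T o\<^sub>L mult_op c"
    using adjoint_pair_unique adjointables_commute[OF assms] by metis
qed

text \<open>Taking adjoints is isometric, so the adjoints of a convergent sequence are Cauchy as
  well. Their limit is an adjoint of the limit, because the inner product is continuous.\<close>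

lemma adjointables_closed:
  assumes X: "\<And>n. X n \<in> adjointables" and lim: "X \<longlonglongrightarrow> T"
  shows "T \<in> adjointables"
proof -
  have "Cauchy (\<lambda>n. op_adj (X n))"
    unfolding Cauchy_def dist_norm
  proof (intro allI impI)
    fix e :: real assume "e > 0"
    then obtain M where M: "\<And>i j. i \<ge> M \<Longrightarrow> j \<ge> M \<Longrightarrow> norm (X i - X j) < e"
      using LIMSEQ_imp_Cauchy[OF lim] unfolding Cauchy_def dist_norm by meson
    have "norm (op_adj (X i) - op_adj (X j)) = norm (X i - X j)" for i j
      by (intro adjoint_pair_norm adjoint_pair_diff adjoint_pair_op_adj X)
    with M show "\<exists>M. \<forall>i\<ge>M. \<forall>j\<ge>M. norm (op_adj (X i) - op_adj (X j)) < e"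
      by metis
  qed
  then obtain U where U: "(\<lambda>n. op_adj (X n)) \<longlonglongrightarrow> U"
    unfolding Cauchy_convergent_iff convergent_def by blast
  show ?thesis
  proof (rule adjointablesI)
    show "mult_op c o\<^sub>L T = T o\<^sub>L mult_op c" for c
    proof (rule LIMSEQ_unique)
      show "(\<lambda>n. mult_op c o\<^sub>L X n) \<longlonglongrightarrow> (mult_op c o\<^sub>L T)"
        by (intro tendsto_intros lim)
      show "(\<lambda>n. mult_op c o\<^sub>L X n) \<longlonglongrightarrow> (T o\<^sub>L mult_op c)"
        unfolding adjointables_commute[OF X] by (intro tendsto_intros lim)
    qed
    show "adjoint_pair T U"
      unfolding adjoint_pair_def
    proof (intro allI)
      fix x y
      show "inner (T x) y = inner x (U y)"
      proof (rule LIMSEQ_unique)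
        show "(\<lambda>n. inner (X n x) y) \<longlonglongrightarrow> inner (T x) y"
          by (intro tendsto_intros lim)
        have "inner (X n x) y = inner x (op_adj (X n) y)" for n
          using adjoint_pair_op_adj[OF X] by (simp add: adjoint_pair_def)
        moreover have "(\<lambda>n. inner x (op_adj (X n) y)) \<longlonglongrightarrow> inner x (U y)"
          by (intro tendsto_intros U)
        ultimately show "(\<lambda>n. inner (X n x) y) \<longlonglongrightarrow> inner x (U y)" by simp
      qed
    qed
  qed
qed

text \<open>The universal property only tests algebras on \<^typ>\<open>test_elem\<close>, so the operators are
  transported there along an injection.\<close>

definition enc :: "(ell2 \<Rightarrow>\<^sub>L ell2) \<Rightarrow> test_elem" where
  "enc T v = coord (T (Abs_ell2 v))"

definition dec :: "test_elem \<Rightarrow> (ell2 \<Rightarrow>\<^sub>L ell2)" where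
  "dec = Hilbert_Choice.inv enc"

lemma inj_enc: "inj enc"
proof (rule injI, rule blinfun_eqI)
  fix T U and x :: ell2
  assume "enc T = enc U"
  \<comment> \<open>Sequences that are not square summable are mapped by \<open>Abs_ell2\<close> to
    an unspecified vector; evaluation at \<open>coord x\<close> avoids them.\<close>
  then have "enc T (coord x) = enc U (coord x)" by simp
  then show "T x = U x" by (simp add: enc_def coord_inverse coord_inject)
qed

lemma dec_enc [simp]: "dec (enc T) = T"
  by (simp add: dec_def inj_enc)

lemma enc_eq_iff [simp]: "enc T = enc U \<longleftrightarrow> T = U"
  by (simp add: inj_eq[OF inj_enc])

text \<open>Scalar multiplication is composition with \<open>mult_op c\<close>, since the type of
  bounded operators itself carries only real scalars.\<close>

definition operator_algebra :: "test_elem cstar_struct" where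
  "operator_algebra =
    \<lparr>carrier = enc ` adjointables,
     monoid.mult = (\<lambda>a b. enc (dec a o\<^sub>L dec b)),
     one = enc id_blinfun,
     zero = enc 0,
     add = (\<lambda>a b. enc (dec a + dec b)),
     smult = (\<lambda>c a. enc (mult_op c o\<^sub>L dec a)),
     adj = (\<lambda>a. enc (op_adj (dec a))),
     cnrm = (\<lambda>a. norm (dec a))\<rparr>"

lemma operator_algebra_simps [simp]:
  "carrier operator_algebra = enc ` adjointables"
  "enc T \<otimes>\<^bsub>operator_algebra\<^esub> enc U = enc (T o\<^sub>L U)"
  "\<one>\<^bsub>operator_algebra\<^esub> = enc id_blinfun"
  "\<zero>\<^bsub>operator_algebra\<^esub> = enc 0"
  "enc T \<oplus>\<^bsub>operator_algebra\<^esub> enc U = enc (T + U)"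
  "c \<odot>\<^bsub>operator_algebra\<^esub> enc T = enc (mult_op c o\<^sub>L T)"
  "adj operator_algebra (enc T) = enc (op_adj T)"
  "cnrm operator_algebra (enc T) = norm T"
  by (simp_all add: operator_algebra_def)

section \<open>Verification of the C*-algebra axioms\<close>

lemma cring_complex_ring: "cring complex_ring"
proof (rule cringI)
  show "abelian_group complex_ring"
    by (rule abelian_groupI) (auto simp: complex_ring_def intro: exI[of _ "- _"])
  show "Group.comm_monoid complex_ring"
    by (rule comm_monoidI) (auto simp: complex_ring_def)
qed (auto simp: complex_ring_def distrib_right)

lemma operator_algebra_abelian_group: "abelian_group operator_algebra"
proof (rule abelian_groupI)
  show "\<exists>y\<in>carrier operator_algebra. y \<oplus>\<^bsub>operator_algebra\<^esub> x = \<zero>\<^bsub>operator_algebra\<^esub>"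
    if "x \<in> carrier operator_algebra" for x
  proof -
    obtain T where x: "x = enc T" "T \<in> adjointables"
      using \<open>x \<in> carrier operator_algebra\<close> by auto
    then show ?thesis
      by (intro bexI[of _ "enc (- T)"]) (auto intro: adjointables_uminus)
  qed
qed (auto simp: adjointables_0 adjointables_add add_ac)

lemma operator_algebra_ring: "ring operator_algebra"
proof (rule ringI)
  show "abelian_group operator_algebra" by (rule operator_algebra_abelian_group)
  show "monoid operator_algebra"
    by (rule monoidI)
      (auto simp: adjointables_compose adjointables_id blinfun_compose_id blinfun_compose_assoc)
qed (auto simp: blinfun_compose_bilinear)

lemma operator_algebra_module: "module complex_ring operator_algebra"
proof (intro module.intro module_axioms.intro)
  show "cring complex_ring" by (rule cring_complex_ring)
  show "abelian_group operator_algebra" by (rule operator_algebra_abelian_group)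
qed (auto simp: adjointables_compose adjointables_mult_op complex_ring_def mult_op_add mult_op_mult
    mult_op_one blinfun_compose_bilinear blinfun_compose_id
    blinfun_compose_assoc)

lemma operator_algebra_pre_cstar: "pre_cstar_algebra operator_algebra"
proof (intro pre_cstar_algebra.intro pre_cstar_algebra_axioms.intro)
  show "module complex_ring operator_algebra" by (rule operator_algebra_module)
  show "ring operator_algebra" by (rule operator_algebra_ring)
  fix x y :: test_elem and c
  assume "x \<in> carrier operator_algebra"
  then obtain T where x: "x = enc T" "T \<in> adjointables" by auto
  note T = adjoint_pair_op_adj[OF x(2)]
  show "adj operator_algebra x \<in> carrier operator_algebra"
    using x by (simp add: adjointables_op_adj)
  show "adj operator_algebra (adj operator_algebra x) = x"
    using x by (simp add: op_adj_eq[OF adjoint_pair_sym[OF T]])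
  show "adj operator_algebra (c \<odot>\<^bsub>operator_algebra\<^esub> x) =
      cnj c \<odot>\<^bsub>operator_algebra\<^esub> adj operator_algebra x"
    using x by (simp add: op_adj_eq[OF adjoint_pair_compose[OF adjoint_pair_mult_op T]]
        adjointables_commute[OF adjointables_op_adj])
  show "0 \<le> cnrm operator_algebra x" using x by simp
  show "cnrm operator_algebra x = 0 \<longleftrightarrow> x = \<zero>\<^bsub>operator_algebra\<^esub>" using x by simp
  show "cnrm operator_algebra (c \<odot>\<^bsub>operator_algebra\<^esub> x) = cmod c * cnrm operator_algebra x"
    using x by (simp add: norm_mult_op_compose)
  show "cnrm operator_algebra (adj operator_algebra x \<otimes>\<^bsub>operator_algebra\<^esub> x) =
      (cnrm operator_algebra x)\<^sup>2"
    using x by (simp add: adjoint_pair_cstar_identity[OF T])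
  assume "y \<in> carrier operator_algebra"
  then obtain U where y: "y = enc U" "U \<in> adjointables" by auto
  note U = adjoint_pair_op_adj[OF y(2)]
  show "(c \<odot>\<^bsub>operator_algebra\<^esub> x) \<otimes>\<^bsub>operator_algebra\<^esub> y =
      c \<odot>\<^bsub>operator_algebra\<^esub> (x \<otimes>\<^bsub>operator_algebra\<^esub> y)"
    using x y by (simp add: blinfun_compose_assoc)
  show "x \<otimes>\<^bsub>operator_algebra\<^esub> (c \<odot>\<^bsub>operator_algebra\<^esub> y) =
      c \<odot>\<^bsub>operator_algebra\<^esub> (x \<otimes>\<^bsub>operator_algebra\<^esub> y)"
    using x y by (simp add: blinfun_compose_assoc[symmetric] adjointables_commute[symmetric])
  show "adj operator_algebra (x \<oplus>\<^bsub>operator_algebra\<^esub> y) =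
      adj operator_algebra x \<oplus>\<^bsub>operator_algebra\<^esub> adj operator_algebra y"
    using x y by (simp add: op_adj_eq[OF adjoint_pair_add[OF T U]])
  show "adj operator_algebra (x \<otimes>\<^bsub>operator_algebra\<^esub> y) =
      adj operator_algebra y \<otimes>\<^bsub>operator_algebra\<^esub> adj operator_algebra x"
    using x y by (simp add: op_adj_eq[OF adjoint_pair_compose[OF T U]])
  show "cnrm operator_algebra (x \<oplus>\<^bsub>operator_algebra\<^esub> y) \<le>
      cnrm operator_algebra x + cnrm operator_algebra y"
    using x y by (simp add: norm_triangle_ineq)
  show "cnrm operator_algebra (x \<otimes>\<^bsub>operator_algebra\<^esub> y) \<le>
      cnrm operator_algebra x * cnrm operator_algebra y"
    using x y by (simp add: norm_blinfun_compose)
qed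

lemma operator_algebra_minus:
  assumes "T \<in> adjointables" "U \<in> adjointables"
  shows "enc T \<ominus>\<^bsub>operator_algebra\<^esub> enc U = enc (T - U)"
proof -
  interpret abelian_group operator_algebra by (rule operator_algebra_abelian_group)
  have "\<ominus>\<^bsub>operator_algebra\<^esub> enc U = enc (- U)"
    using assms by (intro minus_equality) (auto intro: adjointables_uminus)
  then show ?thesis by (simp add: a_minus_def)
qed

lemma cdist_operator_algebra:
  "T \<in> adjointables \<Longrightarrow> U \<in> adjointables \<Longrightarrow> cdist operator_algebra (enc T) (enc U) = dist T U"
  by (simp add: cdist_def operator_algebra_minus dist_norm)

text \<open>On the carrier \<open>cdist\<close> is the distance of the operator norm. The bounded
  operators on the complete space \<open>ell2\<close> are complete, and \<open>adjointables\<close>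
  is closed among them.\<close>

lemma operator_algebra_cstar: "cstar_algebra operator_algebra"
proof -
  interpret pre_cstar_algebra operator_algebra by (rule operator_algebra_pre_cstar)
  show ?thesis
  proof (unfold_locales, unfold mcomplete_def, intro allI impI)
    fix s assume s: "MCauchy s"
    define X where "X n = dec (s n)" for n
    have X: "X n \<in> adjointables" "s n = enc (X n)" for n
    proof -
      have "s n \<in> carrier operator_algebra" using s unfolding MCauchy_def by blast
      then show "X n \<in> adjointables" "s n = enc (X n)" by (auto simp: X_def)
    qed
    have "\<forall>e>0. \<exists>M. \<forall>i j. M \<le> i \<longrightarrow> M \<le> j \<longrightarrow> dist (X i) (X j) < e"
      using s unfolding MCauchy_def by (simp add: X cdist_operator_algebra)
    then have "Cauchy X"
      unfolding Cauchy_def by meson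
    then obtain T where T: "X \<longlonglongrightarrow> T"
      unfolding Cauchy_convergent_iff convergent_def by blast
    then have TA: "T \<in> adjointables" by (rule adjointables_closed[OF X(1)])
    have "limitin mtopology s (enc T) sequentially"
      unfolding limitin_metric_dist_null
      using TA T by (simp add: X cdist_operator_algebra tendsto_dist_iff[symmetric])
    then show "\<exists>x. limitin mtopology s x sequentially" by blast
  qed
qed

section \<open>A Cuntz--Krieger family on sequences\<close>

text \<open>Reindexing along the injection \<open>g\<close>. The first part makes
  \<open>pull\<close> well defined, the second bounds its norm by 1.\<close>

lemma pull_square:
  fixes x :: "nat \<Rightarrow> complex"
  assumes "inj_on g E"
  shows "(\<lambda>n. (cmod (if n \<in> E then x (g n) else 0))\<^sup>2) summable_on UNIV \<longleftrightarrow>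
      (\<lambda>n. (cmod (x n))\<^sup>2) summable_on g ` E"
    and "(\<Sum>\<^sub>\<infinity>n. (cmod (if n \<in> E then x (g n) else 0))\<^sup>2) = (\<Sum>\<^sub>\<infinity>n\<in>g ` E. (cmod (x n))\<^sup>2)"
proof -
  have "(\<lambda>n. (cmod (if n \<in> E then x (g n) else 0))\<^sup>2) summable_on UNIV \<longleftrightarrow>
      ((\<lambda>n. (cmod (x n))\<^sup>2) \<circ> g) summable_on E"
    by (rule summable_on_cong_neutral) auto
  then show "(\<lambda>n. (cmod (if n \<in> E then x (g n) else 0))\<^sup>2) summable_on UNIV \<longleftrightarrow>
      (\<lambda>n. (cmod (x n))\<^sup>2) summable_on g ` E"
    by (simp add: summable_on_reindex[OF assms])
  have "(\<Sum>\<^sub>\<infinity>n. (cmod (if n \<in> E then x (g n) else 0))\<^sup>2) = infsum ((\<lambda>n. (cmod (x n))\<^sup>2) \<circ> g) E"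
    by (rule infsum_cong_neutral) auto
  then show "(\<Sum>\<^sub>\<infinity>n. (cmod (if n \<in> E then x (g n) else 0))\<^sup>2) = (\<Sum>\<^sub>\<infinity>n\<in>g ` E. (cmod (x n))\<^sup>2)"
    by (simp add: infsum_reindex[OF assms])
qed

text \<open>For \<open>g\<close> injective on \<open>E\<close> this is a partial isometry: compose
  with \<open>g\<close> on \<open>E\<close> and extend by zero. Injectivity is what makes
  \<open>Abs_ell2\<close> and \<open>Blinfun\<close> return the intended objects.\<close>

definition pull :: "nat set \<Rightarrow> (nat \<Rightarrow> nat) \<Rightarrow> ell2 \<Rightarrow>\<^sub>L ell2" where
  "pull E g = Blinfun (\<lambda>x. Abs_ell2 (\<lambda>n. if n \<in> E then coord x (g n) else 0))"

lemma coord_pull: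
  assumes "inj_on g E"
  shows "coord (pull E g x) n = (if n \<in> E then coord x (g n) else 0)"
proof -
  let ?f = "\<lambda>x n. if n \<in> E then coord x (g n) else 0"
  have sub: "(\<lambda>n. (cmod (coord x n))\<^sup>2) summable_on g ` E" for x
    by (rule summable_on_subset_banach[OF summable_coord]) simp
  have c: "coord (Abs_ell2 (?f x)) = ?f x" for x
    by (rule Abs_ell2_inverse) (simp add: pull_square(1)[OF assms] sub)
  have "bounded_linear (\<lambda>x. Abs_ell2 (?f x))"
  proof (rule bounded_linear_intro[where K = 1])
    fix x
    have "(norm (Abs_ell2 (?f x)))\<^sup>2 = (\<Sum>\<^sub>\<infinity>n\<in>g ` E. (cmod (coord x n))\<^sup>2)"
      by (simp add: norm_ell2_sq c pull_square(2)[OF assms])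
    also have "\<dots> \<le> (norm x)\<^sup>2"
      unfolding norm_ell2_sq by (rule infsum_mono2[OF sub summable_coord]) auto
    finally show "norm (Abs_ell2 (?f x)) \<le> norm x * 1"
      by (simp add: power2_le_iff_abs_le)
  qed (auto intro!: ell2_eqI simp: c plus_ell2.rep_eq coord_scaleR)
  then show ?thesis by (simp add: pull_def bounded_linear_Blinfun_apply c)
qed

text \<open>The substitution \<open>m = g n\<close> carries the sum over \<open>E\<close> to the sum
  over \<open>F\<close>.\<close>

lemma adjoint_pair_pull:
  assumes g: "bij_betw g E F" and f: "bij_betw f F E" and fg: "\<And>n. n \<in> E \<Longrightarrow> f (g n) = n"
  shows "adjoint_pair (pull E g) (pull F f)"
  unfolding adjoint_pair_def
proof (intro allI)
  fix x y
  have "inner (pull E g x) y = (\<Sum>\<^sub>\<infinity>n\<in>E. inner (coord x (g n)) (coord y (f (g n))))"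
    unfolding inner_ell2.rep_eq coord_pull[OF bij_betw_imp_inj_on[OF g]]
    by (rule infsum_cong_neutral) (auto simp: fg)
  also have "\<dots> = (\<Sum>\<^sub>\<infinity>n\<in>F. inner (coord x n) (coord y (f n)))"
    by (rule infsum_reindex_bij_betw[OF g])
  also have "\<dots> = inner x (pull F f y)"
    unfolding inner_ell2.rep_eq coord_pull[OF bij_betw_imp_inj_on[OF f]]
    by (rule infsum_cong_neutral) auto
  finally show "inner (pull E g x) y = inner x (pull F f y)" .
qed

lemma pull_adjointable:
  assumes "inj_on g E"
  shows "pull E g \<in> adjointables" "op_adj (pull E g) = pull (g ` E) (inv_into E g)"
proof -
  have *: "adjoint_pair (pull E g) (pull (g ` E) (inv_into E g))"
    using assms by (intro adjoint_pair_pull inj_on_imp_bij_betw bij_betw_inv_into) simp_all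
  show "op_adj (pull E g) = pull (g ` E) (inv_into E g)" by (rule op_adj_eq[OF *])
  show "pull E g \<in> adjointables"
    by (rule adjointablesI[OF _ *])
      (auto intro!: blinfun_eqI ell2_eqI simp: mult_op.rep_eq cscale.rep_eq coord_pull[OF assms])
qed

section \<open>Diagonal projections\<close>

definition diag :: "nat set \<Rightarrow> ell2 \<Rightarrow>\<^sub>L ell2" where
  "diag E = pull E id"

lemma coord_diag: "coord (diag E x) n = (if n \<in> E then coord x n else 0)"
  by (simp add: diag_def coord_pull)

lemma diag_adjointable: "diag E \<in> adjointables"
  unfolding diag_def by (rule pull_adjointable) simp

lemma diag_UNIV: "diag UNIV = id_blinfun"
  by (auto intro!: blinfun_eqI ell2_eqI simp: coord_diag)

text \<open>Evaluate at the unit vector of \<open>n\<close>: the projection gives 1 or 0 there, the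
  scalar gives \<open>c\<close>. As \<open>c\<close> does not depend on \<open>n\<close>, a scalar
  diagonal projection treats all points alike.\<close>

lemma diag_eq_mult_opD:
  assumes "diag E = mult_op c"
  shows "n \<in> E \<longleftrightarrow> c = 1"
proof -
  let ?e = "Abs_ell2 (\<lambda>m. if m = n then 1 else 0)"
  have "(\<lambda>m. (cmod (if m = n then 1 else 0))\<^sup>2) summable_on UNIV \<longleftrightarrow> (\<lambda>_. 1 :: real) summable_on {n}"
    by (rule summable_on_cong_neutral) auto
  then have "coord ?e n = 1"
    by (subst Abs_ell2_inverse) auto
  moreover have "coord (diag E ?e) n = coord (mult_op c ?e) n" by (simp add: assms)
  ultimately show ?thesis by (auto simp: coord_diag mult_op.rep_eq cscale.rep_eq split: if_splits)
qed

section \<open>Finite sums and the return element\<close>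

lemma coord_sum: "coord (\<Sum>i\<in>I. f i) n = (\<Sum>i\<in>I. coord (f i) n)"
  by (induction I rule: infinite_finite_induct) (simp_all add: zero_ell2.rep_eq plus_ell2.rep_eq)

lemma finsum_operator_algebra:
  assumes "finite I" "\<And>i. i \<in> I \<Longrightarrow> F i \<in> adjointables"
  shows "(\<Oplus>\<^bsub>operator_algebra\<^esub>i\<in>I. enc (F i)) = enc (\<Sum>i\<in>I. F i)"
proof -
  interpret abelian_group operator_algebra by (rule operator_algebra_abelian_group)
  show ?thesis using assms
  proof (induction I rule: finite_induct)
    case (insert i I)
    then show ?case by (subst finsum_insert) (auto simp: Pi_def)
  qed simp
qed

text \<open>For a Cuntz-Krieger family this is the canonical completely positive map, which acts on
  the diagonal subalgebra as composition with the one-sided shift.\<close>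

definition ck_shift ::
  "nat \<Rightarrow> ('a, 'm) cstar_struct_scheme \<Rightarrow> (nat \<Rightarrow> 'a) \<Rightarrow> 'a \<Rightarrow> 'a" where
  "ck_shift N B S x = (\<Oplus>\<^bsub>B\<^esub>j\<in>{..<N}. S j \<otimes>\<^bsub>B\<^esub> x \<otimes>\<^bsub>B\<^esub> adj B (S j))"

text \<open>The sum of \<open>S\<^sub>\<mu> S\<^sub>\<mu>\<^sup>*\<close> over the words \<open>\<mu>\<close> of length \<open>k + 2\<close> with equal first and last letter; the
  letters in between are summed by \<^const>\<open>ck_shift\<close>.\<close>

definition return_element ::
  "nat \<Rightarrow> ('a, 'm) cstar_struct_scheme \<Rightarrow> (nat \<Rightarrow> 'a) \<Rightarrow> nat \<Rightarrow> 'a" where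
  "return_element N B S k = (\<Oplus>\<^bsub>B\<^esub>i\<in>{..<N}.
     S i \<otimes>\<^bsub>B\<^esub> (ck_shift N B S ^^ k) (S i \<otimes>\<^bsub>B\<^esub> adj B (S i)) \<otimes>\<^bsub>B\<^esub> adj B (S i))"

text \<open>The letter of a point \<open>n\<close> is its residue mod \<open>N\<close>. By the
  bijections, the letters along an orbit of \<sigma> form a path in the graph of \<open>A\<close>,
  and every point has exactly one preimage for each letter allowed to precede its own.\<close>

locale ck_model =
  fixes N :: nat and A :: "nat mat" and \<sigma> :: "nat \<Rightarrow> nat"
  assumes N_pos: "0 < N"
    and zero_one: "zero_one_mat N A"
    and \<sigma>: "i < N \<Longrightarrow> bij_betw \<sigma> {n. n mod N = i} {n. A $$ (i, n mod N) = 1}"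
begin

abbreviation R :: "nat \<Rightarrow> nat set" where "R i \<equiv> {n. n mod N = i}"

abbreviation D :: "nat \<Rightarrow> nat set" where "D i \<equiv> {n. A $$ (i, n mod N) = 1}"

definition T :: "nat \<Rightarrow> ell2 \<Rightarrow>\<^sub>L ell2" where "T i = pull (R i) \<sigma>"

lemma inj_\<sigma>: "i < N \<Longrightarrow> inj_on \<sigma> (R i)" and image_\<sigma>: "i < N \<Longrightarrow> \<sigma> ` R i = D i"
  using \<sigma> by (auto dest: bij_betw_imp_inj_on bij_betw_imp_surj_on)

lemma T_adjointable: "i < N \<Longrightarrow> T i \<in> adjointables"
  unfolding T_def by (rule pull_adjointable[OF inj_\<sigma>])

lemma op_adj_T: "i < N \<Longrightarrow> op_adj (T i) = pull (D i) (inv_into (R i) \<sigma>)"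
  by (simp add: T_def pull_adjointable(2)[OF inj_\<sigma>] image_\<sigma>)

lemma coord_T: "i < N \<Longrightarrow> coord (T i x) n = (if n mod N = i then coord x (\<sigma> n) else 0)"
  by (simp add: T_def coord_pull[OF inj_\<sigma>])

lemma coord_op_adj_T:
  "i < N \<Longrightarrow> coord (op_adj (T i) x) n =
    (if A $$ (i, n mod N) = 1 then coord x (inv_into (R i) \<sigma> n) else 0)"
  using inj_on_inv_into[of "D i" \<sigma> "R i"] by (simp add: op_adj_T coord_pull image_\<sigma>)

lemma inv_\<sigma>:
  assumes "i < N"
  shows "n mod N = i \<Longrightarrow> inv_into (R i) \<sigma> (\<sigma> n) = n" "n mod N = i \<Longrightarrow> A $$ (i, \<sigma> n mod N) = 1"
    "A $$ (i, n mod N) = 1 \<Longrightarrow> inv_into (R i) \<sigma> n mod N = i"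
    "A $$ (i, n mod N) = 1 \<Longrightarrow> \<sigma> (inv_into (R i) \<sigma> n) = n"
  using inv_into_f_f[OF inj_\<sigma>[OF assms], of n] image_\<sigma>[OF assms]
    inv_into_into[of n \<sigma> "R i"] f_inv_into_f[of n \<sigma> "R i"] by auto

text \<open>\<open>T i\<close> composes with \<sigma> on \<open>R i\<close>, its adjoint with the
  inverse branch, and on \<open>R i\<close> the branch undoes \<sigma>. Thus conjugation pulls an
  indicator function back along \<sigma> and restricts it to \<open>R i\<close>.\<close>

lemma T_diag_T: "i < N \<Longrightarrow> (T i o\<^sub>L diag E) o\<^sub>L op_adj (T i) = diag (R i \<inter> \<sigma> -` E)"
  by (intro blinfun_eqI ell2_eqI) (simp add: coord_T coord_diag coord_op_adj_T inv_\<sigma>)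

lemma T_adj_T: "i < N \<Longrightarrow> T i o\<^sub>L op_adj (T i) = diag (R i)"
  using T_diag_T[of i UNIV] by (simp add: diag_UNIV blinfun_compose_id)

text \<open>The inverse branch used by \<open>op_adj (T i)\<close> takes values in
  \<open>R i\<close>, where \<open>T k\<close> yields only zeros if \<open>k\<close> differs from
  \<open>i\<close>.\<close>

lemma adj_T_T:
  "i < N \<Longrightarrow> k < N \<Longrightarrow> op_adj (T i) o\<^sub>L T k = (if i = k then diag (D i) else 0)"
  by (intro blinfun_eqI ell2_eqI)
    (auto simp: coord_T coord_diag coord_op_adj_T inv_\<sigma> zero_ell2.rep_eq)

text \<open>The sets \<open>R i\<close> partition the natural numbers: at \<open>n\<close> only the
  summand \<open>i = n mod N\<close> contributes, and \<open>N_pos\<close> puts this index in the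
  range of summation.\<close>

lemma sum_diag: "(\<Sum>i<N. diag (R i \<inter> Q i)) = diag {n. n \<in> Q (n mod N)}"
proof (intro blinfun_eqI ell2_eqI)
  fix x n
  have "coord ((\<Sum>i<N. diag (R i \<inter> Q i)) x) n =
      (\<Sum>i<N. if n mod N = i \<and> n \<in> Q i then coord x n else 0)"
    by (simp add: blinfun.sum_left coord_sum coord_diag)
  also have "\<dots> = (\<Sum>i<N. if i = n mod N then (if n \<in> Q i then coord x n else 0) else 0)"
    by (rule sum.cong) auto
  also have "\<dots> = coord (diag {n. n \<in> Q (n mod N)} x) n"
    using N_pos by (subst sum.delta) (simp_all add: coord_diag)
  finally show "coord ((\<Sum>i<N. diag (R i \<inter> Q i)) x) n = coord (diag {n. n \<in> Q (n mod N)} x) n" .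
qed

lemma ck_family_model: "ck_family N A operator_algebra (\<lambda>i. enc (T i))"
  unfolding ck_family_def
proof (intro conjI allI impI)
  note [simp] = T_adjointable T_adj_T adj_T_T diag_adjointable
  show "enc (T i) \<in> carrier operator_algebra" if "i < N" for i
    using that by simp
  have "(\<Oplus>\<^bsub>operator_algebra\<^esub>j\<in>{..<N}. enc (T j) \<otimes>\<^bsub>operator_algebra\<^esub> adj operator_algebra (enc (T j))) =
      enc (\<Sum>j<N. T j o\<^sub>L op_adj (T j))"
    unfolding operator_algebra_simps
    by (rule finsum_operator_algebra) auto
  also have "(\<Sum>j<N. T j o\<^sub>L op_adj (T j)) = (\<Sum>j<N. diag (R j \<inter> UNIV))"
    by (intro sum.cong) auto
  finally show "(\<Oplus>\<^bsub>operator_algebra\<^esub>j\<in>{..<N}. enc (T j) \<otimes>\<^bsub>operator_algebra\<^esub> adj operator_algebra (enc (T j)))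
      = \<one>\<^bsub>operator_algebra\<^esub>"
    unfolding sum_diag by (simp add: diag_UNIV)
  fix i k assume ik: "i < N" "k < N"
  let ?a = "\<lambda>j. of_nat (A $$ (i, j)) :: complex"
  have "(\<Oplus>\<^bsub>operator_algebra\<^esub>j\<in>{..<N}. ?a j \<odot>\<^bsub>operator_algebra\<^esub>
        (enc (T j) \<otimes>\<^bsub>operator_algebra\<^esub> adj operator_algebra (enc (T j)))) =
      enc (\<Sum>j<N. mult_op (?a j) o\<^sub>L (T j o\<^sub>L op_adj (T j)))"
    unfolding operator_algebra_simps
    by (rule finsum_operator_algebra) (auto simp: adjointables_compose adjointables_mult_op)
  \<comment> \<open>The entries are 0 or 1, so the scalar keeps or kills the whole projection
    \<open>diag (R j)\<close>. Correspondingly the set intersected with \<open>R j\<close>, whose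
    condition does not mention \<open>n\<close>, is everything or empty.\<close>
  also have "(\<Sum>j<N. mult_op (?a j) o\<^sub>L (T j o\<^sub>L op_adj (T j))) =
      (\<Sum>j<N. diag (R j \<inter> {n. A $$ (i, j) = 1}))"
  proof (rule sum.cong)
    fix j assume "j \<in> {..<N}"
    then have "A $$ (i, j) = 0 \<or> A $$ (i, j) = 1"
      using zero_one ik by (auto simp: zero_one_mat_def)
    then show "mult_op (?a j) o\<^sub>L (T j o\<^sub>L op_adj (T j)) = diag (R j \<inter> {n. A $$ (i, j) = 1})"
      using \<open>j \<in> {..<N}\<close>
      by (auto intro!: blinfun_eqI ell2_eqI simp: mult_op.rep_eq cscale.rep_eq coord_diag)
  qed simp
  also have "\<dots> = diag (D i)"
    unfolding sum_diag by simp
  finally have sum: "(\<Oplus>\<^bsub>operator_algebra\<^esub>j\<in>{..<N}. ?a j \<odot>\<^bsub>operator_algebra\<^esub>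
        (enc (T j) \<otimes>\<^bsub>operator_algebra\<^esub> adj operator_algebra (enc (T j)))) = enc (diag (D i))" .
  show "adj operator_algebra (enc (T i)) \<otimes>\<^bsub>operator_algebra\<^esub> enc (T k) =
      (if i = k then \<Oplus>\<^bsub>operator_algebra\<^esub>j\<in>{..<N}. ?a j \<odot>\<^bsub>operator_algebra\<^esub>
          (enc (T j) \<otimes>\<^bsub>operator_algebra\<^esub> adj operator_algebra (enc (T j)))
       else \<zero>\<^bsub>operator_algebra\<^esub>)"
    unfolding sum using ik by simp
qed

text \<open>The set may depend on the letter: the shift uses a constant family, the return element
  one that remembers the first letter.\<close>

lemma finsum_T_diag_T:
  "(\<Oplus>\<^bsub>operator_algebra\<^esub>i\<in>{..<N}. enc (T i) \<otimes>\<^bsub>operator_algebra\<^esub> enc (diag (E i))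
      \<otimes>\<^bsub>operator_algebra\<^esub> adj operator_algebra (enc (T i))) = enc (diag {n. \<sigma> n \<in> E (n mod N)})"
proof -
  have "(\<Oplus>\<^bsub>operator_algebra\<^esub>i\<in>{..<N}. enc (T i) \<otimes>\<^bsub>operator_algebra\<^esub> enc (diag (E i))
      \<otimes>\<^bsub>operator_algebra\<^esub> adj operator_algebra (enc (T i))) =
      enc (\<Sum>i<N. (T i o\<^sub>L diag (E i)) o\<^sub>L op_adj (T i))"
    unfolding operator_algebra_simps
    by (rule finsum_operator_algebra) (auto simp: T_diag_T diag_adjointable)
  also have "(\<Sum>i<N. (T i o\<^sub>L diag (E i)) o\<^sub>L op_adj (T i)) = (\<Sum>i<N. diag (R i \<inter> \<sigma> -` E i))"
    by (rule sum.cong) (auto simp: T_diag_T)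
  finally show ?thesis unfolding sum_diag by simp
qed

section \<open>The return element in the model\<close>

lemma ck_shift_model:
  "(ck_shift N operator_algebra (\<lambda>i. enc (T i)) ^^ k) (enc (diag E)) = enc (diag ((\<sigma> ^^ k) -` E))"
proof (induction k)
  case (Suc k)
  have "(ck_shift N operator_algebra (\<lambda>i. enc (T i)) ^^ Suc k) (enc (diag E)) =
      ck_shift N operator_algebra (\<lambda>i. enc (T i)) (enc (diag ((\<sigma> ^^ k) -` E)))"
    using Suc by simp
  also have "\<dots> = enc (diag {n. \<sigma> n \<in> (\<sigma> ^^ k) -` E})"
    unfolding ck_shift_def by (rule finsum_T_diag_T)
  also have "{n. \<sigma> n \<in> (\<sigma> ^^ k) -` E} = (\<sigma> ^^ Suc k) -` E"
    by (auto simp: funpow_swap1)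
  finally show ?case .
qed simp

text \<open>The innermost product is \<open>diag (R i)\<close>. The shifts pull it back along
  \<open>k\<close> steps of \<sigma>; the outer conjugation adds one more step and requires the
  starting point to lie in \<open>R i\<close>.\<close>

lemma return_element_model:
  "return_element N operator_algebra (\<lambda>i. enc (T i)) k =
    enc (diag {n. (\<sigma> ^^ Suc k) n mod N = n mod N})"
proof -
  interpret abelian_group operator_algebra by (rule operator_algebra_abelian_group)
  have "return_element N operator_algebra (\<lambda>i. enc (T i)) k =
     (\<Oplus>\<^bsub>operator_algebra\<^esub>i\<in>{..<N}. enc (T i) \<otimes>\<^bsub>operator_algebra\<^esub> enc (diag ((\<sigma> ^^ k) -` R i))
      \<otimes>\<^bsub>operator_algebra\<^esub> adj operator_algebra (enc (T i)))"
    unfolding return_element_def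
  proof (rule finsum_cong')
    fix i assume "i \<in> {..<N}"
    then have "enc (T i) \<otimes>\<^bsub>operator_algebra\<^esub> adj operator_algebra (enc (T i)) = enc (diag (R i))"
      by (simp add: T_adj_T)
    then show "enc (T i) \<otimes>\<^bsub>operator_algebra\<^esub>
        (ck_shift N operator_algebra (\<lambda>i. enc (T i)) ^^ k)
          (enc (T i) \<otimes>\<^bsub>operator_algebra\<^esub> adj operator_algebra (enc (T i)))
        \<otimes>\<^bsub>operator_algebra\<^esub> adj operator_algebra (enc (T i)) =
      enc (T i) \<otimes>\<^bsub>operator_algebra\<^esub> enc (diag ((\<sigma> ^^ k) -` R i))
        \<otimes>\<^bsub>operator_algebra\<^esub> adj operator_algebra (enc (T i))"
      by (simp only: ck_shift_model)
  qed (auto simp: T_diag_T diag_adjointable)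
  also have "\<dots> = enc (diag {n. (\<sigma> ^^ Suc k) n mod N = n mod N})"
    unfolding finsum_T_diag_T by (simp add: funpow_swap1)
  finally show ?thesis .
qed

text \<open>The orbit is built backwards from its end point, which is why \<open>n\<close> is
  generalized in the induction. The exact end point is prescribed, so in particular its letter
  is.\<close>

lemma path_from_power:
  assumes "0 < (A ^\<^sub>m k) $$ (i, n mod N)" "i < N"
  shows "\<exists>m. m mod N = i \<and> (\<sigma> ^^ k) m = n"
  using assms(1)
proof (induction k arbitrary: n)
  case 0
  have "A \<in> carrier_mat N N" using zero_one by (simp add: zero_one_mat_def)
  with 0 \<open>i < N\<close> N_pos show ?case by (auto split: if_splits)
next
  case (Suc k)
  have A: "A \<in> carrier_mat N N" "A ^\<^sub>m k \<in> carrier_mat N N"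
    using zero_one by (auto simp: zero_one_mat_def)
  have "0 < (\<Sum>l<N. (A ^\<^sub>m k) $$ (i, l) * A $$ (l, n mod N))"
    using Suc.prems A \<open>i < N\<close> N_pos by (simp add: scalar_prod_def atLeast0LessThan)
  \<comment> \<open>A positive sum of natural numbers has a positive term; \<open>l\<close> is the
    last letter before that of \<open>n\<close>.\<close>
  then obtain l where l: "l < N" "0 < (A ^\<^sub>m k) $$ (i, l)" "0 < A $$ (l, n mod N)"
    by (metis (no_types, lifting) lessThan_iff nat_0_less_mult_iff neq0_conv sum.neutral)
  moreover have "A $$ (l, n mod N) \<in> {0, 1}"
    using zero_one l(1) N_pos by (simp add: zero_one_mat_def)
  ultimately have "n \<in> \<sigma> ` R l" by (simp add: image_\<sigma>)
  then obtain m where m: "m mod N = l" "\<sigma> m = n" by auto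
  then show ?case using Suc.IH[of m] l(2) by auto
qed

end

text \<open>Any two infinite sets of natural numbers are in bijection, and the target of letter
  \<open>i\<close> is infinite as soon as row \<open>i\<close> of \<open>A\<close> contains a 1.
  Primitivity excludes zero rows.\<close>

lemma ck_model_exists:
  assumes "0 < N" "zero_one_mat N A" "primitive_mat N A"
  obtains \<sigma> where "ck_model N A \<sigma>"
proof -
  have A: "A \<in> carrier_mat N N" "A ^\<^sub>m k \<in> carrier_mat N N" for k
    using assms(2) by (auto simp: zero_one_mat_def)
  obtain k where k: "k \<ge> 1" "\<And>i j. i < N \<Longrightarrow> j < N \<Longrightarrow> 0 < (A ^\<^sub>m k) $$ (i, j)"
    using assms(3) by (auto simp: primitive_mat_def)
  have row: "\<exists>j<N. A $$ (i, j) = 1" if i: "i < N" for i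
  proof (rule ccontr)
    assume "\<not> (\<exists>j<N. A $$ (i, j) = 1)"
    then have z: "A $$ (i, j) = 0" if "j < N" for j
      using assms(2) i that by (auto simp: zero_one_mat_def)
    \<comment> \<open>A zero row stays zero under multiplication by \<open>A\<close> from the right.
      The statement starts at the first power, the zeroth being the identity matrix.\<close>
    have "(A ^\<^sub>m Suc m) $$ (i, j) = 0" if "j < N" for j m
      using that
    proof (induction m arbitrary: j)
      case 0
      then show ?case using z A by simp
    next
      case (Suc m)
      have "A ^\<^sub>m Suc (Suc m) = A ^\<^sub>m Suc m * A" by simp
      then show ?case
        using Suc A(2)[of "Suc m"] A(1) i by (simp add: scalar_prod_def del: pow_mat.simps)
    qed
    with k(2)[OF i i] k(1) i show False by (metis Suc_le_D less_numeral_extra(3) One_nat_def)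
  qed
  have inf: "infinite {n. n mod N = j}" if "j < N" for j
  proof -
    have "range (\<lambda>q. j + N * q) \<subseteq> {n. n mod N = j}" using that by auto
    moreover have "inj (\<lambda>q. j + N * q)" using \<open>0 < N\<close> by (auto intro: injI)
    ultimately show ?thesis using range_inj_infinite infinite_super by blast
  qed
  have "\<exists>h. bij_betw h {n. n mod N = i} {n. A $$ (i, n mod N) = 1}" if i: "i < N" for i
  proof -
    obtain j where "j < N" "A $$ (i, j) = 1" using row[OF i] by blast
    then have "{n. n mod N = j} \<subseteq> {n. A $$ (i, n mod N) = 1}" by auto
    then have D: "infinite {n. A $$ (i, n mod N) = 1}"
      using inf[OF \<open>j < N\<close>] infinite_super by blast
    \<comment> \<open>Undo the increasing enumeration of the source, then apply that of the
      target.\<close>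
    show ?thesis
      using bij_betw_trans[OF bij_betw_inv_into[OF bij_enumerate[OF inf[OF i]]] bij_enumerate[OF D]]
      by blast
  qed
  then obtain h where h: "\<And>i. i < N \<Longrightarrow> bij_betw (h i) {n. n mod N = i} {n. A $$ (i, n mod N) = 1}"
    by metis
  \<comment> \<open>The sources are disjoint residue classes, so the separate bijections glue to one
    map.\<close>
  have "bij_betw (\<lambda>n. h (n mod N) n) {n. n mod N = i} {n. A $$ (i, n mod N) = 1}" if "i < N" for i
    by (rule bij_betw_cong[THEN iffD2, OF _ h[OF that]]) simp
  then have "ck_model N A (\<lambda>n. h (n mod N) n)"
    using assms by (simp add: ck_model_def)
  then show thesis by (rule that)
qed

section \<open>Invariance of the return element\<close>

lemma ck_shift_closed:
  assumes "pre_cstar_algebra B" "\<And>i. i < N \<Longrightarrow> S i \<in> carrier B" "x \<in> carrier B"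
  shows "ck_shift N B S x \<in> carrier B"
proof -
  interpret pre_cstar_algebra B by fact
  show ?thesis unfolding ck_shift_def using assms(2,3) by (intro M.finsum_closed) auto
qed

lemma ck_shift_pow_closed:
  assumes "pre_cstar_algebra B" "\<And>i. i < N \<Longrightarrow> S i \<in> carrier B" "x \<in> carrier B"
  shows "(ck_shift N B S ^^ k) x \<in> carrier B"
  by (induction k) (simp_all add: assms ck_shift_closed)

lemma return_element_closed:
  assumes "pre_cstar_algebra B" "\<And>i. i < N \<Longrightarrow> S i \<in> carrier B"
  shows "return_element N B S k \<in> carrier B"
proof -
  interpret pre_cstar_algebra B by fact
  show ?thesis unfolding return_element_def
    by (intro M.finsum_closed) (auto intro!: ck_shift_pow_closed assms)
qed

text \<open>The phases cancel in every product of the form \<open>S\<^sub>i x S\<^sub>i\<^sup>*\<close>.\<close>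

locale phase_permuting_hom = B: pre_cstar_algebra B + C: pre_cstar_algebra C
  for B :: "('a, 'm) cstar_struct_scheme" and C :: "('b, 'n) cstar_struct_scheme" +
  fixes N :: nat and S :: "nat \<Rightarrow> 'a" and T :: "nat \<Rightarrow> 'b" and \<phi> :: "'a \<Rightarrow> 'b"
    and c :: "nat \<Rightarrow> complex" and \<pi> :: "nat \<Rightarrow> nat"
  assumes hom: "\<phi> \<in> star_hom B C"
    and S: "i < N \<Longrightarrow> S i \<in> carrier B" and T: "i < N \<Longrightarrow> T i \<in> carrier C"
    and perm: "\<pi> permutes {..<N}"
    and gen: "i < N \<Longrightarrow> \<phi> (S i) = c i \<odot>\<^bsub>C\<^esub> T (\<pi> i)"
    and phase: "i < N \<Longrightarrow> cmod (c i) = 1"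
begin

lemma ring_hom_ring: "ring_hom_ring B C \<phi>"
  using hom by (intro ring_hom_ringI2) (auto simp: star_hom_def B.ring_axioms C.ring_axioms)

lemma perm_less: "i < N \<Longrightarrow> \<pi> i < N"
  using permutes_in_image[OF perm, of i] by simp

lemma hom_conj:
  assumes i: "i < N" and x: "x \<in> carrier B"
  shows "\<phi> (S i \<otimes>\<^bsub>B\<^esub> x \<otimes>\<^bsub>B\<^esub> adj B (S i)) = T (\<pi> i) \<otimes>\<^bsub>C\<^esub> \<phi> x \<otimes>\<^bsub>C\<^esub> adj C (T (\<pi> i))"
proof -
  interpret h: ring_hom_ring B C \<phi> by (rule ring_hom_ring)
  have t: "T (\<pi> i) \<in> carrier C" using T perm_less i by blast
  have y: "\<phi> x \<in> carrier C" using x by simp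
  have sm: "a \<odot>\<^bsub>C\<^esub> u \<in> carrier C" if "u \<in> carrier C" for a u
    using that by (intro C.smult_closed) (simp_all add: complex_ring_def)
  have "\<phi> (S i \<otimes>\<^bsub>B\<^esub> x \<otimes>\<^bsub>B\<^esub> adj B (S i)) =
      (c i \<odot>\<^bsub>C\<^esub> T (\<pi> i)) \<otimes>\<^bsub>C\<^esub> \<phi> x \<otimes>\<^bsub>C\<^esub> (cnj (c i) \<odot>\<^bsub>C\<^esub> adj C (T (\<pi> i)))"
    using hom S[OF i] x gen[OF i] t by (simp add: star_hom_def C.adj_smult)
  also have "\<dots> = (c i * cnj (c i)) \<odot>\<^bsub>C\<^esub> (T (\<pi> i) \<otimes>\<^bsub>C\<^esub> \<phi> x \<otimes>\<^bsub>C\<^esub> adj C (T (\<pi> i)))"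
    using t y C.smult_assoc1[of "cnj (c i)" "c i" "T (\<pi> i) \<otimes>\<^bsub>C\<^esub> \<phi> x \<otimes>\<^bsub>C\<^esub> adj C (T (\<pi> i))"]
    by (simp add: C.smult_mult_left C.smult_mult_right sm complex_ring_def mult.commute[of "c i"])
  also have "c i * cnj (c i) = 1"
    using phase[OF i] by (simp add: complex_norm_square[symmetric])
  finally show ?thesis
    using t y C.smult_one[of "T (\<pi> i) \<otimes>\<^bsub>C\<^esub> \<phi> x \<otimes>\<^bsub>C\<^esub> adj C (T (\<pi> i))"] by (simp add: complex_ring_def)
qed

text \<open>The homomorphism turns summand \<open>i\<close> into summand \<open>\<pi> i\<close>, and
  a permutation does not change the sum. The middle factors may vary with \<open>i\<close> as long
  as they are permuted in the same way.\<close>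

lemma hom_sum_conj:
  assumes x: "\<And>i. i < N \<Longrightarrow> x i \<in> carrier B" and y: "\<And>i. i < N \<Longrightarrow> y i \<in> carrier C"
    and xy: "\<And>i. i < N \<Longrightarrow> \<phi> (x i) = y (\<pi> i)"
  shows "\<phi> (\<Oplus>\<^bsub>B\<^esub>i\<in>{..<N}. S i \<otimes>\<^bsub>B\<^esub> x i \<otimes>\<^bsub>B\<^esub> adj B (S i)) =
    (\<Oplus>\<^bsub>C\<^esub>i\<in>{..<N}. T i \<otimes>\<^bsub>C\<^esub> y i \<otimes>\<^bsub>C\<^esub> adj C (T i))"
proof -
  interpret h: ring_hom_ring B C \<phi> by (rule ring_hom_ring)
  let ?g = "\<lambda>i. T i \<otimes>\<^bsub>C\<^esub> y i \<otimes>\<^bsub>C\<^esub> adj C (T i)"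
  have "\<phi> (\<Oplus>\<^bsub>B\<^esub>i\<in>{..<N}. S i \<otimes>\<^bsub>B\<^esub> x i \<otimes>\<^bsub>B\<^esub> adj B (S i)) =
      (\<Oplus>\<^bsub>C\<^esub>i\<in>{..<N}. (\<phi> \<circ> (\<lambda>i. S i \<otimes>\<^bsub>B\<^esub> x i \<otimes>\<^bsub>B\<^esub> adj B (S i))) i)"
    using S x by (intro h.hom_finsum) auto
  also have "\<dots> = (\<Oplus>\<^bsub>C\<^esub>i\<in>{..<N}. ?g (\<pi> i))"
    using T y perm_less by (intro C.M.finsum_cong') (auto simp: hom_conj x xy)
  also have "\<dots> = (\<Oplus>\<^bsub>C\<^esub>i\<in>\<pi> ` {..<N}. ?g i)"
    using T y perm_less
    by (intro C.M.finsum_reindex[symmetric]) (auto intro: inj_on_subset[OF permutes_inj[OF perm]])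
  also have "\<pi> ` {..<N} = {..<N}" by (rule permutes_image[OF perm])
  finally show ?thesis .
qed

text \<open>This serves twice: for the automorphisms of the action it gives invariance, and for the
  homomorphism into the model, with trivial phases and permutation, it computes the image.\<close>

lemma hom_return_element: "\<phi> (return_element N B S k) = return_element N C T k"
proof -
  interpret h: ring_hom_ring B C \<phi> by (rule ring_hom_ring)
  have closed: "(ck_shift N B S ^^ m) x \<in> carrier B" if "x \<in> carrier B" for x m
    by (rule ck_shift_pow_closed[OF B.pre_cstar_algebra_axioms S that])
  have closed': "(ck_shift N C T ^^ m) y \<in> carrier C" if "y \<in> carrier C" for y m
    by (rule ck_shift_pow_closed[OF C.pre_cstar_algebra_axioms T that])
  have pow: "\<phi> ((ck_shift N B S ^^ m) x) = (ck_shift N C T ^^ m) (\<phi> x)" if x: "x \<in> carrier B" for x m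
  proof (induction m)
    case (Suc m)
    then show ?case
      using x hom_sum_conj[of "\<lambda>_. (ck_shift N B S ^^ m) x" "\<lambda>_. (ck_shift N C T ^^ m) (\<phi> x)"]
      by (simp add: closed closed' ck_shift_def[symmetric])
  qed simp
  \<comment> \<open>The innermost range projections are conjugates of the unit, so they are permuted
    too.\<close>
  have "\<phi> (S i \<otimes>\<^bsub>B\<^esub> adj B (S i)) = T (\<pi> i) \<otimes>\<^bsub>C\<^esub> adj C (T (\<pi> i))" if "i < N" for i
    using hom_conj[OF that, of "\<one>\<^bsub>B\<^esub>"] S[OF that] T[OF perm_less[OF that]] by simp
  then show ?thesis
    unfolding return_element_def using S T perm_less
    by (intro hom_sum_conj) (auto simp: pow closed closed')
qed

end

section \<open>The return element is not a scalar\<close>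

lemma star_hom_scalar:
  assumes "\<phi> \<in> star_hom B C" "ring B"
  shows "\<phi> (c \<odot>\<^bsub>B\<^esub> \<one>\<^bsub>B\<^esub>) = c \<odot>\<^bsub>C\<^esub> \<one>\<^bsub>C\<^esub>"
proof -
  interpret ring B by fact
  show ?thesis using assms by (auto simp: star_hom_def ring_hom_one)
qed

lemma return_element_not_scalar:
  assumes N: "N \<ge> 2" and A: "zero_one_mat N A"
    and k: "\<And>i j. i < N \<Longrightarrow> j < N \<Longrightarrow> 0 < (A ^\<^sub>m Suc k) $$ (i, j)"
    and ck: "cuntz_krieger_algebra N A \<O> S"
  shows "return_element N \<O> S k \<notin> scalars \<O>"
proof
  assume "return_element N \<O> S k \<in> scalars \<O>"
  then obtain c where c: "return_element N \<O> S k = c \<odot>\<^bsub>\<O>\<^esub> \<one>\<^bsub>\<O>\<^esub>" by (auto simp: scalars_def)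
  have "primitive_mat N A"
    unfolding primitive_mat_def using k by (intro exI[of _ "Suc k"]) auto
  then obtain \<sigma> where "ck_model N A \<sigma>"
    using ck_model_exists[of N A] N A by (metis zero_less_two less_le_trans pos2)
  then interpret ck_model N A \<sigma> .
  obtain \<phi> where \<phi>: "\<phi> \<in> star_hom \<O> operator_algebra" "\<And>i. i < N \<Longrightarrow> \<phi> (S i) = enc (T i)"
    using ck operator_algebra_cstar ck_family_model unfolding cuntz_krieger_algebra_def by blast
  have O: "pre_cstar_algebra \<O>" and S: "\<And>i. i < N \<Longrightarrow> S i \<in> carrier \<O>"
    using ck by (auto simp: cuntz_krieger_algebra_def ck_family_def cstar_algebra_def)
  interpret phase_permuting_hom \<O> operator_algebra N S "\<lambda>i. enc (T i)" \<phi> "\<lambda>_. 1" id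
  proof (intro phase_permuting_hom.intro phase_permuting_hom_axioms.intro O operator_algebra_pre_cstar)
    show "\<phi> (S i) = 1 \<odot>\<^bsub>operator_algebra\<^esub> enc (T (id i))" if "i < N" for i
      using that by (simp add: \<phi> mult_op_one blinfun_compose_id)
  qed (use \<phi> S in \<open>auto simp: T_adjointable permutes_id\<close>)
  \<comment> \<open>If the return element were the scalar \<open>c\<close>, its image in the model
    would be both a diagonal projection and \<open>mult_op c\<close>.\<close>
  have "enc (diag {n. (\<sigma> ^^ Suc k) n mod N = n mod N}) = enc (mult_op c)"
    using hom_return_element[of k] star_hom_scalar[OF \<phi>(1) B.ring_axioms, of c] c
    by (simp add: return_element_model blinfun_compose_id del: funpow.simps)
  then have D: "(\<sigma> ^^ Suc k) n mod N = n mod N \<longleftrightarrow> c = 1" for n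
    using diag_eq_mult_opD[of "{n. (\<sigma> ^^ Suc k) n mod N = n mod N}" c n] by simp
  have path: "\<exists>m. m mod N = i \<and> (\<sigma> ^^ Suc k) m = j" if "i < N" "j < N" for i j
    using path_from_power[of "Suc k" i j] k that by simp
  have "0 < N" "1 < N" using N by auto
  \<comment> \<open>Both \<open>m\<close> and \<open>m'\<close> have letter 0, but their orbits end
    at the points 0 and 1. As \<open>N \<ge> 2\<close>, these have different letters, so
    \<open>m\<close> returns to its letter and \<open>m'\<close> does not, contradicting
    \<open>D\<close>.\<close>
  obtain m where "m mod N = 0" "(\<sigma> ^^ Suc k) m = 0"
    using path[OF \<open>0 < N\<close> \<open>0 < N\<close>] by (elim exE conjE)
  moreover obtain m' where "m' mod N = 0" "(\<sigma> ^^ Suc k) m' = 1"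
    using path[OF \<open>0 < N\<close> \<open>1 < N\<close>] by (elim exE conjE)
  ultimately show False
    using D[of m] D[of m'] N by simp
qed

text \<open>In the factorization of \<open>(z, \<pi>)\<close> the permutation acts first and the
  gauge automorphism second, so the phase is \<open>z (\<pi> i)\<close> and not
  \<open>z i\<close>.\<close>

lemma wreath_action_gen:
  assumes act: "wreath_action N A \<O> S \<alpha>" and g: "(z, \<pi>) \<in> carrier (torus_wreath N A)"
    and S: "\<And>i. i < N \<Longrightarrow> S i \<in> carrier \<O>" and i: "i < N"
  shows "\<alpha> (z, \<pi>) (S i) = z (\<pi> i) \<odot>\<^bsub>\<O>\<^esub> S (\<pi> i)"
proof -
  interpret group_action "torus_wreath N A" "carrier \<O>" \<alpha>
    using act by (simp add: wreath_action_def)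
  have z: "z \<in> torus N" and \<pi>: "\<pi> \<in> mat_aut N A" using g by (auto simp: torus_wreath_def)
  have \<pi>i: "\<pi> i < N" using \<pi> i permutes_in_image[of \<pi> "{..<N}" i] by (simp add: mat_aut_def)
  have "torus_one N \<in> torus N" by (auto simp: torus_def)
  moreover have "id \<in> mat_aut N A" by (simp add: mat_aut_def permutes_id)
  moreover have "(z, \<pi>) = (z, id) \<otimes>\<^bsub>torus_wreath N A\<^esub> (torus_one N, \<pi>)"
    using z by (auto simp: torus_wreath_def torus_def PiE_def extensional_def fun_eq_iff)
  ultimately have "\<alpha> (z, \<pi>) (S i) = \<alpha> (z, id) (\<alpha> (torus_one N, \<pi>) (S i))"
    using composition_rule[OF S[OF i], of "(z, id)" "(torus_one N, \<pi>)"] z \<pi>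
    by (simp add: torus_wreath_def)
  also have "\<dots> = z (\<pi> i) \<odot>\<^bsub>\<O>\<^esub> S (\<pi> i)"
    using act z \<pi> i \<pi>i by (simp add: wreath_action_def)
  finally show ?thesis .
qed

theorem proposition5p16:
  fixes N :: nat and A :: "nat mat"
    and \<O> :: "('a, 'm) cstar_struct_scheme" and S :: "nat \<Rightarrow> 'a"
    and \<alpha> :: "(nat \<Rightarrow> complex) \<times> (nat \<Rightarrow> nat) \<Rightarrow> 'a \<Rightarrow> 'a"
  assumes "N \<ge> 2"
    and "zero_one_mat N A"
    and "primitive_mat N A"
    and "cuntz_krieger_algebra N A \<O> S"
    and "wreath_action N A \<O> S \<alpha>"
  shows "\<not> ergodic_action (torus_wreath N A) \<O> \<alpha> \<and>
    scalars \<O> \<subset> fixed_point_algebra (torus_wreath N A) \<O> \<alpha>"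
proof -
  have O: "pre_cstar_algebra \<O>" and S: "\<And>i. i < N \<Longrightarrow> S i \<in> carrier \<O>"
    using assms(4) by (auto simp: cuntz_krieger_algebra_def ck_family_def cstar_algebra_def)
  interpret pre_cstar_algebra \<O> by (rule O)
  let ?F = "fixed_point_algebra (torus_wreath N A) \<O> \<alpha>"
  \<comment> \<open>The exponent from primitivity is at least 1; it is written \<open>Suc k\<close>,
    where \<open>k\<close> counts the letters strictly between the first and the last.\<close>
  obtain k where k: "\<And>i j. i < N \<Longrightarrow> j < N \<Longrightarrow> 0 < (A ^\<^sub>m Suc k) $$ (i, j)"
    using assms(3) unfolding primitive_mat_def by (metis Suc_le_D One_nat_def)
  have hom: "\<alpha> g \<in> star_hom \<O> \<O>" if "g \<in> carrier (torus_wreath N A)" for g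
    using assms(5) that by (simp add: wreath_action_def)
  have "scalars \<O> \<subseteq> ?F"
  proof
    fix x assume "x \<in> scalars \<O>"
    then obtain c where x: "x = c \<odot>\<^bsub>\<O>\<^esub> \<one>\<^bsub>\<O>\<^esub>" by (auto simp: scalars_def)
    have "x \<in> carrier \<O>"
      unfolding x by (intro smult_closed) (simp_all add: complex_ring_def)
    then show "x \<in> ?F"
      using star_hom_scalar[OF hom ring_axioms] by (simp add: fixed_point_algebra_def x)
  qed
  moreover have "return_element N \<O> S k \<in> ?F"
    unfolding fixed_point_algebra_def
  proof (intro CollectI conjI ballI return_element_closed O S)
    fix g assume g: "g \<in> carrier (torus_wreath N A)"
    obtain z \<pi> where z: "g = (z, \<pi>)" "z \<in> torus N" "\<pi> \<in> mat_aut N A"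
      using g by (auto simp: torus_wreath_def)
    have \<pi>: "\<pi> permutes {..<N}" using z(3) by (simp add: mat_aut_def)
    \<comment> \<open>Source and target family coincide here, so the image of the return element is
      the return element itself.\<close>
    interpret phase_permuting_hom \<O> \<O> N S S "\<alpha> g" "\<lambda>i. z (\<pi> i)" \<pi>
    proof (intro phase_permuting_hom.intro phase_permuting_hom_axioms.intro O S hom g \<pi>)
      show "\<alpha> g (S i) = z (\<pi> i) \<odot>\<^bsub>\<O>\<^esub> S (\<pi> i)" if "i < N" for i
        unfolding z(1)
        by (rule wreath_action_gen[OF assms(5) g[unfolded z(1)]]) (simp_all add: S that)
      show "cmod (z (\<pi> i)) = 1" if "i < N" for i
      proof -
        have "\<pi> i \<in> {..<N}" using permutes_in_image[OF \<pi>] that by blast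
        then have "z (\<pi> i) \<in> sphere 0 1" using z(2) unfolding torus_def by (rule PiE_mem[rotated])
        then show ?thesis by simp
      qed
    qed
    show "\<alpha> g (return_element N \<O> S k) = return_element N \<O> S k"
      by (rule hom_return_element)
  qed
  ultimately have "scalars \<O> \<subset> ?F"
    using return_element_not_scalar[OF assms(1,2) k assms(4)] by blast
  then show ?thesis by (auto simp: ergodic_action_def)
qed

end
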